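(* Let $d\in\mathbb{N}$, $p\in(0,\infty]$, $\alpha\in(0,\infty)$. Let $\boldsymbol{\ell}:\mathbb{N}\to\mathbb{N}_{\ge 2}\cup\{\infty\}$ and $\boldsymbol{c}:\mathbb{N}\to\mathbb{N}\cup\{\infty\}$ be non-decreasing, and assume that there are $\theta\ge 0$ and $\kappa\in\mathbb{R}$ with $\boldsymbol{c}(n)\asymp n^{\theta}\cdot(\ln(2n))^{\kappa}$, i.e. there are constants $K_1,K_2>0$ with $K_1 n^\theta(\ln(2n))^\kappa\le \boldsymbol{c}(n)\le K_2 n^\theta(\ln(2n))^\kappa$ for all $n\in\mathbb{N}$. Set $\boldsymbol{\ell}^\ast:=\sup_{n\in\mathbb{N}}\boldsymbol{\ell}(n)\in\mathbb{N}_{\ge2}\cup\{\infty\}$ and $\gamma^\ast:=\theta\cdot\boldsymbol{\ell}^\ast+\lfloor\boldsymbol{\ell}^\ast/2\rfloor\in[1,\infty]$. Let $\beta\in(0,1)$. Then: (i) If $\alpha>\frac{\beta+\frac{d}{p}}{1-\beta}\cdot\gamma^\ast$, then the embedding $A^{\alpha,p}_{\boldsymbol{\ell},\boldsymbol{c}}([0,1]^d)\hookrightarrow C^{0,\beta}([0,1]^d)$ holds. (ii) If $\alpha<\frac{\beta+\frac{d}{p}}{1-\beta}\cdot\gamma^\ast$, then the embedding $A^{\alpha,p}_{\boldsymbol{\ell},\boldsymbol{c}}([0,1]^d)\hookrightarrow C^{0,\beta}([0,1]^d)$ does not hold.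
   Context: $\mathbb{N}=\{1,2,3,\dots\}$. Conventions: $d/p:=0$ if $p=\infty$; $0\cdot\infty:=0$; $\lfloor\infty/2\rfloor:=\infty$. Neural networks: a neural network is a tuple $\Phi=((A_1,b_1),\dots,(A_L,b_L))$ with $L\in\mathbb{N}$, $A_j\in\mathbb{R}^{N_j\times N_{j-1}}$, $b_j\in\mathbb{R}^{N_j}$, $N_0,\dots,N_L\in\mathbb{N}$. Put $L(\Phi):=L$ (number of layers), $d_{\mathrm{in}}(\Phi):=N_0$, $d_{\mathrm{out}}(\Phi):=N_L$, $W(\Phi):=\sum_{j=1}^L(\|A_j\|_{\ell^0}+\|b_j\|_{\ell^0})$, where $\|\cdot\|_{\ell^0}$ counts non-zero entries, and $\|\Phi\|_{\mathcal{NN}}:=\max_j\max\{\|A_j\|_\infty,\|b_j\|_\infty\}$, where $\|\cdot\|_\infty$ is the largest absolute value of an entry. With the ReLU $\varrho(x)=\max\{0,x\}$ acting componentwise and $T_jx=A_jx+b_j$, the realization is $R_\varrho\Phi:=T_L\circ(\varrho\circ T_{L-1})\circ\cdots\circ(\varrho\circ T_1):\mathbb{R}^{N_0}\to\mathbb{R}^{N_L}$. Approximation spaces: $\Sigma_n^{\boldsymbol{\ell},\boldsymbol{c}}$ is the set of all $R_\varrho\Phi$ with $d_{\mathrm{in}}(\Phi)=d$, $d_{\mathrm{out}}(\Phi)=1$, $W(\Phi)\le n$, $L(\Phi)\le\boldsymbol{\ell}(n)$, $\|\Phi\|_{\mathcal{NN}}\le\boldsymbol{c}(n)$. For measurable $f:[0,1]^d\to\mathbb{R}$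 let $d_p(f,\Sigma):=\inf_{g\in\Sigma}\|f-g\|_{L^p([0,1]^d)}$ and $$\Gamma_{\alpha,p}(f):=\max\Big\{\|f\|_{L^p([0,1]^d)},\ \sup_{n\in\mathbb{N}}\big[n^\alpha\cdot d_p(f,\Sigma_n^{\boldsymbol{\ell},\boldsymbol{c}})\big]\Big\}\in[0,\infty],$$ $\|f\|_{A^{\alpha,p}_{\boldsymbol{\ell},\boldsymbol{c}}}:=\inf\{t>0:\Gamma_{\alpha,p}(f/t)\le1\}\in[0,\infty]$, and $A^{\alpha,p}_{\boldsymbol{\ell},\boldsymbol{c}}([0,1]^d):=\{f\in L^p([0,1]^d):\|f\|_{A^{\alpha,p}_{\boldsymbol{\ell},\boldsymbol{c}}}<\infty\}$ (a quasi-normed space). Hölder spaces: for $\beta\in(0,1]$, $\operatorname{Lip}_\beta(f):=\sup_{x\ne y\in[0,1]^d}\frac{|f(x)-f(y)|}{\|x-y\|_{\ell^\infty}^\beta}$, and $C^{0,\beta}([0,1]^d)$ consists of all $f:[0,1]^d\to\mathbb{R}$ with $\|f\|_{C^{0,\beta}}:=\|f\|_{L^\infty}+\operatorname{Lip}_\beta(f)<\infty$. An embedding $X\hookrightarrow Y$ means that every $f\in X$ belongs to $Y$ (after possibly changing $f$ on a null set) and there is $C>0$ with $\|f\|_Y\le C\|f\|_X$ for all $f\in X$. *)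

theory Defs
  imports
    "HOL-Probability.Essential_Supremum"
    "Jordan_Normal_Form.Matrix"
begin

text \<open>
  Points of \<open>[0,1]\<^sup>d\<close> are elements of \<open>real^'d\<close> with \<open>d = CARD('d)\<close>.  The layers of a network have
  varying widths, so weights and biases are matrices and vectors with explicit dimensions from
  Jordan-Normal-Form.  Since both libraries use the names \<open>vec\<close> and \<open>$\<close>, constants and types that
  clash are written qualified or by their constant names.
\<close>


section \<open>Neural networks\<close>

type_synonym network = "(real mat \<times> real Matrix.vec) list"

definition is_network :: "network \<Rightarrow> bool" where
  "is_network \<Phi> \<longleftrightarrow>
     \<Phi> \<noteq> [] \<and>
     (\<forall>(A, b) \<in> set \<Phi>. dim_row A \<ge> 1 \<and> dim_col A \<ge> 1 \<and> dim_vec b = dim_row A) \<and>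
     (\<forall>j. Suc j < length \<Phi> \<longrightarrow> dim_col (fst (\<Phi> ! Suc j)) = dim_row (fst (\<Phi> ! j)))"

definition d_in :: "network \<Rightarrow> nat" where
  "d_in \<Phi> = dim_col (fst (hd \<Phi>))"

definition d_out :: "network \<Rightarrow> nat" where
  "d_out \<Phi> = dim_row (fst (last \<Phi>))"

abbreviation num_layers :: "network \<Rightarrow> nat" where
  "num_layers \<Phi> \<equiv> length \<Phi>"

definition mat_l0 :: "real mat \<Rightarrow> nat" where
  "mat_l0 A = card {(i, j). i < dim_row A \<and> j < dim_col A \<and> A $$ (i, j) \<noteq> 0}"

definition vec_l0 :: "real Matrix.vec \<Rightarrow> nat" where
  "vec_l0 b = card {i. i < dim_vec b \<and> vec_index b i \<noteq> 0}"

definition num_weights :: "network \<Rightarrow> nat" where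
  "num_weights \<Phi> = (\<Sum>(A, b) \<leftarrow> \<Phi>. mat_l0 A + vec_l0 b)"

definition mat_linf :: "real mat \<Rightarrow> real" where
  "mat_linf A = Max (abs ` elements_mat A)"

definition vec_linf :: "real Matrix.vec \<Rightarrow> real" where
  "vec_linf b = Max (abs ` vec_set b)"

definition weight_norm :: "network \<Rightarrow> real" where
  "weight_norm \<Phi> = Max ((\<lambda>(A, b). max (mat_linf A) (vec_linf b)) ` set \<Phi>)"

definition relu :: "real \<Rightarrow> real" where
  "relu x = max 0 x"

text \<open>The activation is not applied after the last layer.  The first equation is a dummy.\<close>

fun realization :: "network \<Rightarrow> real Matrix.vec \<Rightarrow> real Matrix.vec" where
  "realization [] x = x"
| "realization [(A, b)] x = A *\<^sub>v x + b"
| "realization ((A, b) # l # \<Phi>) x = realization (l # \<Phi>) (map_vec relu (A *\<^sub>v x + b))"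

text \<open>
  The index type \<open>'d\<close> is identified with \<open>{..<CARD('d)}\<close> by a fixed enumeration.  The choice of the
  enumeration does not affect the class \<open>nn_class\<close> below, as one may permute the columns of the
  first weight matrix.
\<close>

definition input_vec :: "real^'d::finite \<Rightarrow> real Matrix.vec" where
  "input_vec x = Matrix.vec CARD('d) (\<lambda>i. vec_nth x (from_nat_into (UNIV :: 'd set) i))"

definition nn_class :: "(nat \<Rightarrow> enat) \<Rightarrow> (nat \<Rightarrow> enat) \<Rightarrow> nat \<Rightarrow> (real^'d::finite \<Rightarrow> real) set" where
  "nn_class \<l> c n =
     {\<lambda>x. vec_index (realization \<Phi> (input_vec x)) 0 | \<Phi>.
        is_network \<Phi> \<and> d_in \<Phi> = CARD('d) \<and> d_out \<Phi> = 1 \<and>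
        num_weights \<Phi> \<le> n \<and> enat (num_layers \<Phi>) \<le> \<l> n \<and>
        ereal (weight_norm \<Phi>) \<le> ereal_of_enat (c n)}"


section \<open>Lebesgue quasi-norms on the unit cube\<close>

text \<open>
  Functions on \<open>[0,1]\<^sup>d\<close> are total functions on \<open>real^'d\<close> whose values outside the cube are
  irrelevant.  Note that \<open>1 :: real^'d\<close> is the vector with all components equal to 1.
\<close>

abbreviation unit_cube :: "(real^'d::finite) set" where
  "unit_cube \<equiv> cbox 0 1"

abbreviation cube_measure :: "(real^'d::finite) measure" where
  "cube_measure \<equiv> lebesgue_on unit_cube"

definition ennreal_powr :: "ennreal \<Rightarrow> real \<Rightarrow> ennreal" where
  "ennreal_powr x r = (if x = \<infinity> then \<infinity> else ennreal (enn2real x powr r))"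

definition Lp_norm :: "ereal \<Rightarrow> (real^'d::finite \<Rightarrow> real) \<Rightarrow> ennreal" where
  "Lp_norm p f =
     (if p = \<infinity> then esssup cube_measure (\<lambda>x. ennreal \<bar>f x\<bar>)
      else ennreal_powr
             (\<integral>\<^sup>+ x. ennreal (\<bar>f x\<bar> powr real_of_ereal p) \<partial>cube_measure) (1 / real_of_ereal p))"

definition Lp_space :: "ereal \<Rightarrow> (real^'d::finite \<Rightarrow> real) set" where
  "Lp_space p = {f \<in> borel_measurable cube_measure. Lp_norm p f < \<infinity>}"

definition Lp_dist :: "ereal \<Rightarrow> (real^'d::finite \<Rightarrow> real) \<Rightarrow> (real^'d \<Rightarrow> real) set \<Rightarrow> ennreal" where
  "Lp_dist p f \<Sigma> = (INF g\<in>\<Sigma>. Lp_norm p (\<lambda>x. f x - g x))"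


section \<open>Approximation spaces\<close>

definition approx_Gamma ::
  "(nat \<Rightarrow> enat) \<Rightarrow> (nat \<Rightarrow> enat) \<Rightarrow> real \<Rightarrow> ereal \<Rightarrow> (real^'d::finite \<Rightarrow> real) \<Rightarrow> ennreal" where
  "approx_Gamma \<l> c \<alpha> p f =
     max (Lp_norm p f)
         (SUP n\<in>{1..}. ennreal (real n powr \<alpha>) * Lp_dist p f (nn_class \<l> c n))"

definition approx_norm ::
  "(nat \<Rightarrow> enat) \<Rightarrow> (nat \<Rightarrow> enat) \<Rightarrow> real \<Rightarrow> ereal \<Rightarrow> (real^'d::finite \<Rightarrow> real) \<Rightarrow> ennreal" where
  "approx_norm \<l> c \<alpha> p f =
     (INF t\<in>{t. t > 0 \<and> approx_Gamma \<l> c \<alpha> p (\<lambda>x. f x / t) \<le> 1}. ennreal t)"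

definition approx_space ::
  "(nat \<Rightarrow> enat) \<Rightarrow> (nat \<Rightarrow> enat) \<Rightarrow> real \<Rightarrow> ereal \<Rightarrow> (real^'d::finite \<Rightarrow> real) set" where
  "approx_space \<l> c \<alpha> p = {f \<in> Lp_space p. approx_norm \<l> c \<alpha> p f < \<infinity>}"


section \<open>Hoelder spaces\<close>

text \<open>\<open>infnorm\<close> is the maximum norm on \<open>real^'d\<close>.\<close>

definition Lip :: "real \<Rightarrow> (real^'d::finite \<Rightarrow> real) \<Rightarrow> ennreal" where
  "Lip \<beta> f =
     (SUP (x, y)\<in>{(x, y). x \<in> unit_cube \<and> y \<in> unit_cube \<and> x \<noteq> y}.
        ennreal (\<bar>f x - f y\<bar> / infnorm (x - y) powr \<beta>))"

definition hoelder_norm :: "real \<Rightarrow> (real^'d::finite \<Rightarrow> real) \<Rightarrow> ennreal" where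
  "hoelder_norm \<beta> f = Lp_norm \<infinity> f + Lip \<beta> f"

definition hoelder_space :: "real \<Rightarrow> (real^'d::finite \<Rightarrow> real) set" where
  "hoelder_space \<beta> = {f. hoelder_norm \<beta> f < \<infinity>}"


section \<open>Embeddings\<close>

text \<open>The function \<open>g\<close> is the representative of \<open>f\<close> obtained by a change on a null set.\<close>

definition embeds ::
  "(real^'d::finite \<Rightarrow> real) set \<Rightarrow> ((real^'d \<Rightarrow> real) \<Rightarrow> ennreal) \<Rightarrow>
   (real^'d \<Rightarrow> real) set \<Rightarrow> ((real^'d \<Rightarrow> real) \<Rightarrow> ennreal) \<Rightarrow> bool" where
  "embeds X normX Y normY \<longleftrightarrow>
     (\<exists>C::real. C > 0 \<and>
        (\<forall>f\<in>X. \<exists>g\<in>Y. (AE x in cube_measure. f x = g x) \<and> normY g \<le> ennreal C * normX f))"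


section \<open>The exponent\<close>

definition enat_half :: "enat \<Rightarrow> enat" where
  "enat_half m = (case m of enat k \<Rightarrow> enat (k div 2) | \<infinity> \<Rightarrow> \<infinity>)"

definition sup_depth :: "(nat \<Rightarrow> enat) \<Rightarrow> enat" where
  "sup_depth \<l> = (SUP n\<in>{1..}. \<l> n)"

text \<open>In \<^typ>\<open>ereal\<close>, \<open>0 * \<infinity> = 0\<close> and \<open>r / \<infinity> = 0\<close> for real \<open>r\<close>.\<close>

definition gamma_star :: "real \<Rightarrow> (nat \<Rightarrow> enat) \<Rightarrow> ereal" where
  "gamma_star \<theta> \<l> =
     ereal \<theta> * ereal_of_enat (sup_depth \<l>) + ereal_of_enat (enat_half (sup_depth \<l>))"

end

theory Submission
  imports Defs "HOL-Real_Asymp.Real_Asymp"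
begin

text \<open>
  Write \<open>\<delta> = d / p\<close>.  A network with at most \<open>n\<close> weights bounded by \<open>C\<close> and at most \<open>L\<close> layers has
  Lipschitz constant at most \<open>d C^L n^(L div 2)\<close>, and up to a constant factor this is attained near a
  corner of the cube, which is why \<open>\<gamma>\<^sup>*\<close> governs the embedding.

  (i) Telescope \<open>f\<close> along near-best approximants from the classes with \<open>2^j\<close> weights.  The differences have
  \<open>L\<^sup>p\<close> size \<open>2^(-\<alpha>j)\<close> and Lipschitz constant \<open>2^(\<gamma>j)\<close> with \<open>\<gamma>\<close> slightly above \<open>\<gamma>\<^sup>*\<close>.  A function with
  \<open>L\<^sup>p\<close> size \<open>K\<close> and Lipschitz constant \<open>M \<ge> K\<close> has sup norm at most of order \<open>(K M^\<delta>)^(1/(1+\<delta>))\<close>;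
  interpolating with the Lipschitz bound, the Hoelder norms of the differences sum up geometrically
  exactly when \<open>\<alpha> (1 - \<beta>) > \<gamma> (\<beta> + \<delta>)\<close>.

  (ii) Bumps of maximal slope at a corner, with height chosen such that their approximation norm is at
  most 1, have unbounded Hoelder norms.
\<close>

section \<open>Lipschitz constants of networks\<close>

text \<open>The two halves meet at one exponent because the bumps are extremal for the interpolation
  step. A bump of slope s and width 1/M has height h = s/M. Prescribing its L^p size h M^(-\<delta>)
  = n^(-\<alpha>) forces M^(1+\<delta>) = s n^\<alpha>, and then (h M^\<beta>)^(1+\<delta>) =
  n^(-\<alpha>(1-\<beta>)) s^(\<beta>+\<delta>). With n = 2^j and s = n^\<gamma> this is the
  geometric rate of the Hoelder norms in the telescoping sum, raised to the power 1+\<delta>. For p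
  < 1 the L^p quasi-norm has no triangle inequality. Differences of approximants are therefore never
  measured in L^p; only the errors f - g are, through the size of their level sets. The logarithm in
  c changes slopes by less than any power of n. Both hypotheses on \<alpha> are strict, so their
  slack absorbs it. For unbounded depth \<gamma>* is infinite: (i) is then vacuous, and (ii) needs
  only one finite depth that is large enough.\<close>

lemma abs_relu_diff_le: "\<bar>relu a - relu b\<bar> \<le> \<bar>a - b\<bar>"
  by (auto simp: relu_def)

lemma mult_mat_vec_entry:
  assumes "i < dim_row A" "dim_vec v = dim_col A"
  shows "vec_index (A *\<^sub>v v) i = (\<Sum>j<dim_col A. A $$ (i, j) * vec_index v j)"
  using assms by (auto simp: scalar_prod_def atLeast0LessThan intro!: sum.cong)

lemma affine_diff_entry:
  fixes A :: "real mat"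
  assumes "i < dim_row A" "dim_vec v = dim_col A" "dim_vec w = dim_col A" "dim_vec b = dim_row A"
  shows "vec_index (A *\<^sub>v v + b) i - vec_index (A *\<^sub>v w + b) i =
         (\<Sum>j<dim_col A. A $$ (i, j) * (vec_index v j - vec_index w j))"
  using assms mult_mat_vec_entry[of i A v] mult_mat_vec_entry[of i A w]
  by (simp add: right_diff_distrib sum_subtractf)

definition entries_le :: "real \<Rightarrow> real mat \<Rightarrow> bool" where
  "entries_le C A \<longleftrightarrow> (\<forall>i<dim_row A. \<forall>j<dim_col A. \<bar>A $$ (i, j)\<bar> \<le> C)"

text \<open>A single output pairs one row with the input difference. Bounding the entries of that
  row by C leaves the l1 norm of the difference, so no count of entries appears.\<close>

lemma affine_l1_linf:
  assumes "entries_le C A" "i < dim_row A"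
    and "dim_vec v = dim_col A" "dim_vec w = dim_col A" "dim_vec b = dim_row A"
    and "(\<Sum>j<dim_col A. \<bar>vec_index v j - vec_index w j\<bar>) \<le> D" "0 \<le> C"
  shows "\<bar>vec_index (A *\<^sub>v v + b) i - vec_index (A *\<^sub>v w + b) i\<bar> \<le> C * D"
proof -
  have "\<bar>vec_index (A *\<^sub>v v + b) i - vec_index (A *\<^sub>v w + b) i\<bar>
      \<le> (\<Sum>j<dim_col A. \<bar>A $$ (i, j) * (vec_index v j - vec_index w j)\<bar>)"
    unfolding affine_diff_entry[OF assms(2-5)] by (rule sum_abs)
  also have "\<dots> \<le> (\<Sum>j<dim_col A. C * \<bar>vec_index v j - vec_index w j\<bar>)"
    using assms(1,2) unfolding entries_le_def
    by (auto simp: abs_mult intro!: sum_mono mult_right_mono)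
  also have "\<dots> \<le> C * D"
    unfolding sum_distrib_left[symmetric] using assms by (intro mult_left_mono) auto
  finally show ?thesis .
qed

text \<open>Only the nonzero entries contribute to the double sum, each at most C D. Hence the
  number of weights enters and the widths of the layers do not.\<close>

lemma affine_linf_l1:
  assumes "entries_le C A" "mat_l0 A \<le> n"
    and "dim_vec v = dim_col A" "dim_vec w = dim_col A" "dim_vec b = dim_row A"
    and "\<And>j. j < dim_col A \<Longrightarrow> \<bar>vec_index v j - vec_index w j\<bar> \<le> D" "0 \<le> C" "0 \<le> D"
  shows "(\<Sum>i<dim_row A. \<bar>vec_index (A *\<^sub>v v + b) i - vec_index (A *\<^sub>v w + b) i\<bar>) \<le> C * real n * D"
proof -
  define S where "S = {(i, j). i < dim_row A \<and> j < dim_col A \<and> A $$ (i, j) \<noteq> 0}"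
  have S: "S \<subseteq> {..<dim_row A} \<times> {..<dim_col A}" by (auto simp: S_def)
  have "(\<Sum>i<dim_row A. \<bar>vec_index (A *\<^sub>v v + b) i - vec_index (A *\<^sub>v w + b) i\<bar>)
      \<le> (\<Sum>i<dim_row A. \<Sum>j<dim_col A. \<bar>A $$ (i, j) * (vec_index v j - vec_index w j)\<bar>)"
    using assms(3-5) by (intro sum_mono) (simp only: affine_diff_entry lessThan_iff sum_abs)
  also have "\<dots> = (\<Sum>(i, j)\<in>{..<dim_row A} \<times> {..<dim_col A}. \<bar>A $$ (i, j) * (vec_index v j - vec_index w j)\<bar>)"
    by (simp add: sum.cartesian_product)
  also have "\<dots> = (\<Sum>(i, j)\<in>S. \<bar>A $$ (i, j) * (vec_index v j - vec_index w j)\<bar>)"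
    by (intro sum.mono_neutral_right S) (auto simp: S_def)
  also have "\<dots> \<le> (\<Sum>(i, j)\<in>S. C * D)"
    using assms unfolding entries_le_def S_def
    by (intro sum_mono) (auto simp: abs_mult intro!: mult_mono)
  also have "\<dots> = real (mat_l0 A) * (C * D)"
    by (simp add: S_def mat_l0_def case_prod_unfold)
  also have "\<dots> \<le> real n * (C * D)"
    using assms by (intro mult_right_mono) auto
  finally show ?thesis by (simp add: mult_ac)
qed

lemma is_network_Cons:
  "is_network ((A, b) # l # \<Phi>) \<longleftrightarrow>
     dim_row A \<ge> 1 \<and> dim_col A \<ge> 1 \<and> dim_vec b = dim_row A \<and>
     is_network (l # \<Phi>) \<and> d_in (l # \<Phi>) = dim_row A"
proof -
  \<comment> \<open>Index 0 of the compatibility condition links the new layer to the next one; the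
    indices Suc j give the condition for the tail.\<close>
  have split: "(\<forall>j. Q j) \<longleftrightarrow> Q 0 \<and> (\<forall>j. Q (Suc j))" for Q :: "nat \<Rightarrow> bool"
    by (metis not0_implies_Suc)
  show ?thesis
    unfolding is_network_def d_in_def
    by (subst split) auto
qed

text \<open>
  Alternating between the \<open>\<ell>\<^sup>1\<close>- and \<open>\<ell>\<^sup>\<infinity>\<close>-norms of the layer outputs, a weight matrix
  costs a factor \<open>C\<close> from \<open>\<ell>\<^sup>1\<close> to \<open>\<ell>\<^sup>\<infinity>\<close> and \<open>C n\<close> back, so that \<open>n\<close> enters only in every second layer.
\<close>
lemma realization_lipschitz:
  assumes "is_network \<Phi>" "dim_vec v = d_in \<Phi>" "dim_vec w = d_in \<Phi>" "0 \<le> C" "0 \<le> D"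
    and "\<And>A b. (A, b) \<in> set \<Phi> \<Longrightarrow> entries_le C A \<and> mat_l0 A \<le> n"
    and "i < d_out \<Phi>"
  shows "(\<Sum>j<d_in \<Phi>. \<bar>vec_index v j - vec_index w j\<bar>) \<le> D \<Longrightarrow>
     \<bar>vec_index (realization \<Phi> v) i - vec_index (realization \<Phi> w) i\<bar>
       \<le> C ^ length \<Phi> * real n ^ (length \<Phi> div 2) * D"
    and "(\<And>j. j < d_in \<Phi> \<Longrightarrow> \<bar>vec_index v j - vec_index w j\<bar> \<le> D) \<Longrightarrow>
     \<bar>vec_index (realization \<Phi> v) i - vec_index (realization \<Phi> w) i\<bar>
       \<le> C ^ length \<Phi> * real n ^ (Suc (length \<Phi>) div 2) * D"
  using assms
proof (induction \<Phi> v arbitrary: w D rule: realization.induct)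
  case (1 x)
  { case 1 then show ?case by (simp add: is_network_def) }
  { case 2 then show ?case by (simp add: is_network_def) }
next
  case (2 A b x)
  { case 1
    then show ?case using affine_l1_linf[of C A i x w b D]
      by (auto simp: is_network_def d_in_def d_out_def) }
  { case prems: 2
    then have i: "i < dim_row A" by (auto simp: d_out_def)
    have "(\<Sum>i<dim_row A. \<bar>vec_index (A *\<^sub>v x + b) i - vec_index (A *\<^sub>v w + b) i\<bar>) \<le> C * real n * D"
      using prems by (intro affine_linf_l1) (auto simp: is_network_def d_in_def d_out_def)
    moreover have "\<bar>vec_index (A *\<^sub>v x + b) i - vec_index (A *\<^sub>v w + b) i\<bar> \<le> 
      (\<Sum>i<dim_row A. \<bar>vec_index (A *\<^sub>v x + b) i - vec_index (A *\<^sub>v w + b) i\<bar>)"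
      using i by (intro member_le_sum) auto
    ultimately show ?case by simp }
next
  case (3 A b l \<Phi> x)
  define T where "T y = map_vec relu (A *\<^sub>v y + b)" for y
  have R: "realization ((A, b) # l # \<Phi>) y = realization (l # \<Phi>) (T y)" for y
    by (simp add: T_def)
  have dim_T: "dim_vec (T y) = dim_vec b" for y by (simp add: T_def)
  { case prems: 1
    have dims: "dim_vec x = dim_col A" "dim_vec w = dim_col A" "dim_vec b = dim_row A"
       "is_network (l # \<Phi>)" "d_in (l # \<Phi>) = dim_row A" "i < d_out (l # \<Phi>)"
      using prems(2-4,8) unfolding is_network_Cons by (simp_all add: d_in_def d_out_def)
    have A: "entries_le C A" using prems(7)[of A b] by simp
    have sum: "(\<Sum>j<dim_col A. \<bar>vec_index x j - vec_index w j\<bar>) \<le> D"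
      using prems(1) by (simp add: d_in_def)
    have D: "\<bar>vec_index (T x) j - vec_index (T w) j\<bar> \<le> C * D" if "j < d_in (l # \<Phi>)" for j
      using affine_l1_linf[OF A _ dims(1-3) sum prems(5), of j] that dims(3,5)
      by (simp add: T_def order_trans[OF abs_relu_diff_le])
    \<comment> \<open>The first layer turned the l1 bound into a maximum bound, so the other claim
      applies to the tail. Its exponent Suc (length of the tail) div 2 is half the full
      length.\<close>
    have "\<bar>vec_index (realization (l # \<Phi>) (T x)) i - vec_index (realization (l # \<Phi>) (T w)) i\<bar>
       \<le> C ^ length (l # \<Phi>) * real n ^ (Suc (length (l # \<Phi>)) div 2) * (C * D)"
    proof (rule "3.IH"(2)[folded T_def])
      show "entries_le C A' \<and> mat_l0 A' \<le> n" if "(A', b') \<in> set (l # \<Phi>)" for A' b'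
        using prems(7)[of A' b'] that by simp
    qed (use D dims prems(5,6) in \<open>simp_all add: dim_T\<close>)
    then show ?case unfolding R by (simp add: mult_ac) }
  { case prems: 2
    have dims: "dim_vec x = dim_col A" "dim_vec w = dim_col A" "dim_vec b = dim_row A"
       "is_network (l # \<Phi>)" "d_in (l # \<Phi>) = dim_row A" "i < d_out (l # \<Phi>)"
      using prems(2-4,8) unfolding is_network_Cons by (simp_all add: d_in_def d_out_def)
    have A: "entries_le C A" "mat_l0 A \<le> n" using prems(7)[of A b] by simp_all
    have "(\<Sum>j<dim_row A. \<bar>vec_index (T x) j - vec_index (T w) j\<bar>)
      \<le> (\<Sum>j<dim_row A. \<bar>vec_index (A *\<^sub>v x + b) j - vec_index (A *\<^sub>v w + b) j\<bar>)"
      using dims(3) by (intro sum_mono) (simp add: T_def order_trans[OF abs_relu_diff_le])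
    also have "\<dots> \<le> C * real n * D"
      using prems(1) by (intro affine_linf_l1[OF A dims(1-3) _ prems(5,6)]) (simp add: d_in_def)
    finally have D: "(\<Sum>j<d_in (l # \<Phi>). \<bar>vec_index (T x) j - vec_index (T w) j\<bar>) \<le> C * real n * D"
      using dims(5) by simp
    \<comment> \<open>Here the first layer contributes the factor n, and the tail starts from an l1
      bound.\<close>
    have "\<bar>vec_index (realization (l # \<Phi>) (T x)) i - vec_index (realization (l # \<Phi>) (T w)) i\<bar>
       \<le> C ^ length (l # \<Phi>) * real n ^ (length (l # \<Phi>) div 2) * (C * real n * D)"
    proof (rule "3.IH"(1)[folded T_def])
      show "entries_le C A' \<and> mat_l0 A' \<le> n" if "(A', b') \<in> set (l # \<Phi>)" for A' b'
        using prems(7)[of A' b'] that by simp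
    qed (use D dims prems(5,6) in \<open>simp_all add: dim_T\<close>)
    then show ?case unfolding R by (simp add: mult_ac) }
qed

section \<open>Lipschitz bounds for the network classes\<close>

lemma entries_le_weight_norm:
  assumes "is_network \<Phi>" "(A, b) \<in> set \<Phi>" "weight_norm \<Phi> \<le> C"
  shows "entries_le C A"
  unfolding entries_le_def
proof safe
  fix i j assume ij: "i < dim_row A" "j < dim_col A"
  have "\<bar>A $$ (i, j)\<bar> \<le> mat_linf A"
    unfolding mat_linf_def
  proof (rule Max_ge)
    show "finite (abs ` elements_mat A)" by (simp add: elements_mat_def)
    show "\<bar>A $$ (i, j)\<bar> \<in> abs ` elements_mat A"
      using ij by (intro imageI elements_matI[of A "dim_row A" "dim_col A"]) auto
  qed
  also have "\<dots> \<le> max (mat_linf A) (vec_linf b)" by simp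
  also have "\<dots> \<le> weight_norm \<Phi>"
    unfolding weight_norm_def using assms(2) by (intro Max_ge) force+
  finally show "\<bar>A $$ (i, j)\<bar> \<le> C" using assms(3) by simp
qed

lemma mat_l0_le_num_weights:
  assumes "(A, b) \<in> set \<Phi>" shows "mat_l0 A \<le> num_weights \<Phi>"
proof -
  have "mat_l0 A + vec_l0 b \<le> num_weights \<Phi>"
    unfolding num_weights_def using assms
    by (intro member_le_sum_list) (force, auto)
  then show ?thesis by simp
qed

text \<open>The coordinates of \<open>input_vec\<close> are used only through sums over all of them,
  and these do not depend on the enumeration.\<close>

lemma sum_input_vec:
  "(\<Sum>i<CARD('d). f (vec_index (input_vec (x :: real^'d::finite)) i) (vec_index (input_vec y) i))
   = (\<Sum>k\<in>UNIV. f (vec_nth x k) (vec_nth y k))"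
proof -
  have "bij_betw (from_nat_into (UNIV :: 'd set)) {..<CARD('d)} UNIV"
    by (rule bij_betw_from_nat_into_finite) simp
  from sum.reindex_bij_betw[OF this, of "\<lambda>k. f (vec_nth x k) (vec_nth y k)"]
  show ?thesis by (simp add: input_vec_def)
qed

text \<open>Passing from the maximum norm to the l1 norm at the input costs the factor d,
  independent of n. In exchange the alternation starts with l1, which gives the exponent L div 2
  rather than Suc L div 2.\<close>

lemma nn_class_lipschitz:
  fixes g :: "real^'d::finite \<Rightarrow> real"
  assumes g: "g \<in> nn_class \<l> c n" and c: "c n = enat C" "C \<ge> 1" and n: "n \<ge> 1" and l: "\<l> n \<le> enat L"
  shows "\<bar>g x - g y\<bar> \<le> real CARD('d) * real C ^ L * real n ^ (L div 2) * infnorm (x - y)"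
proof -
  obtain \<Phi> where \<Phi>: "g = (\<lambda>x. vec_index (realization \<Phi> (input_vec x)) 0)"
    "is_network \<Phi>" "d_in \<Phi> = CARD('d)" "d_out \<Phi> = 1" "num_weights \<Phi> \<le> n"
    "enat (num_layers \<Phi>) \<le> \<l> n" "weight_norm \<Phi> \<le> real C"
    using g c by (auto simp: nn_class_def)
  have len: "length \<Phi> \<le> L" using \<Phi>(6) l by (meson enat_ord_simps(1) order_trans)
  define D where "D = real CARD('d) * infnorm (x - y)"
  have D0: "0 \<le> D" by (simp add: D_def infnorm_pos_le)
  have "(\<Sum>k\<in>UNIV. \<bar>vec_nth x k - vec_nth y k\<bar>) \<le> (\<Sum>k\<in>(UNIV::'d set). infnorm (x - y))"
    by (intro sum_mono) (metis component_le_infnorm_cart vector_minus_component)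
  then have sm: "(\<Sum>j<d_in \<Phi>. \<bar>vec_index (input_vec x) j - vec_index (input_vec y) j\<bar>) \<le> D"
    using sum_input_vec[of "\<lambda>a b. \<bar>a - b\<bar>" x y] by (simp add: \<Phi>(3) D_def)
  have bounds: "entries_le (real C) A \<and> mat_l0 A \<le> n" if "(A, b) \<in> set \<Phi>" for A b
    using entries_le_weight_norm[OF \<Phi>(2) that \<Phi>(7)] mat_l0_le_num_weights[OF that] \<Phi>(5) by simp
  have "\<bar>g x - g y\<bar> \<le> real C ^ length \<Phi> * real n ^ (length \<Phi> div 2) * D"
    unfolding \<Phi>(1)
    by (rule realization_lipschitz(1))
       (use \<Phi>(2-5) D0 sm bounds in \<open>auto simp: input_vec_def\<close>)
  \<comment> \<open>Networks may be shallower than L; since C and n are at least 1, larger exponents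
    only weaken the bound.\<close>
  also have "\<dots> \<le> real C ^ L * real n ^ (L div 2) * D"
    using len c n D0 by (intro mult_right_mono mult_mono power_increasing div_le_mono) auto
  finally show ?thesis by (simp add: D_def mult_ac)
qed

section \<open>Lebesgue and Hoelder norms on the cube\<close>

text \<open>Markov's inequality in a form that includes p = \<infinity>: there the exponent is 0,
  the power of the positive measure is 1, and a \<le> K remains.\<close>

lemma Lp_norm_level_set:
  fixes h :: "real^'d::finite \<Rightarrow> real"
  assumes p: "0 < p" and h[measurable]: "h \<in> borel_measurable cube_measure"
    and K: "Lp_norm p h \<le> ennreal K" "0 \<le> K" and a: "0 \<le> a"
    and E[measurable]: "E \<in> sets cube_measure" and Ea: "\<And>x. x \<in> E \<Longrightarrow> a \<le> \<bar>h x\<bar>"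
    and pos: "measure cube_measure E > 0"
  shows "a * measure cube_measure E powr real_of_ereal (1 / p) \<le> K"
proof (cases "p = \<infinity>")
  case True
  have "AE x in cube_measure. ennreal \<bar>h x\<bar> \<le> Lp_norm p h"
    using esssup_AE[of "\<lambda>x. ennreal \<bar>h x\<bar>" cube_measure] True by (simp add: Lp_norm_def)
  then have ae: "AE x in cube_measure. \<bar>h x\<bar> \<le> K"
    by eventually_elim (meson K ennreal_le_iff order_trans)
  have "\<exists>x\<in>E. \<bar>h x\<bar> \<le> K"
  proof (rule ccontr)
    assume *: "\<not> ?thesis"
    from ae have "AE x in cube_measure. x \<notin> E" by eventually_elim (use * in auto)
    then have "E \<in> null_sets cube_measure"
      using AE_iff_null_sets[OF E] by simp
    then show False using pos by (simp add: measure_def null_sets_def)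
  qed
  then have "a \<le> K" using Ea by force
  then show ?thesis using True pos by simp
next
  case False
  then obtain r where r: "p = ereal r" "0 < r" using p by (cases p) auto
  define m where "m = measure cube_measure E"
  define I where "I = (\<integral>\<^sup>+ x. ennreal (\<bar>h x\<bar> powr r) \<partial>cube_measure)"
  have N: "ennreal_powr I (1 / r) \<le> ennreal K" using K(1) r by (simp add: Lp_norm_def I_def)
  then have fin: "I \<noteq> \<infinity>" by (auto simp: ennreal_powr_def top_unique)
  then have IK: "enn2real I powr (1 / r) \<le> K" using N K(2) by (simp add: ennreal_powr_def)
  \<comment> \<open>Positive \<open>measure\<close> excludes infinite mass, which
    \<open>enn2real\<close> would send to 0.\<close>
  have Efin: "emeasure cube_measure E = ennreal m"
    using pos unfolding m_def by (intro emeasure_eq_ennreal_measure) (auto simp: measure_def)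
  have "ennreal (a powr r * m) = (\<integral>\<^sup>+ x. ennreal (a powr r) * indicator E x \<partial>cube_measure)"
    by (subst nn_integral_cmult_indicator) (auto simp: Efin ennreal_mult m_def)
  also have "\<dots> \<le> I"
    unfolding I_def using Ea a r
    by (intro nn_integral_mono) (auto split: split_indicator intro!: powr_mono2)
  finally have "a powr r * m \<le> enn2real I"
    using fin by (metis enn2real_mono enn2real_ennreal infinity_ennreal_def less_top m_def measure_nonneg powr_ge_zero mult_nonneg_nonneg)
  then have "(a powr r * m) powr (1 / r) \<le> enn2real I powr (1 / r)"
    using r by (intro powr_mono2) (auto simp: m_def)
  also have "(a powr r * m) powr (1 / r) = a * m powr (1 / r)"
    using r a by (simp add: powr_mult m_def powr_powr)
  finally show ?thesis using IK r by (simp add: m_def one_ereal_def)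
qed

section \<open>Small cubes inside the unit cube\<close>

lemma cube_measure_subset:
  assumes "E \<in> sets lebesgue" "E \<subseteq> (unit_cube :: (real^'d::finite) set)"
  shows "E \<in> sets cube_measure" "measure cube_measure E = measure lebesgue E"
  using assms by (auto simp: sets_restrict_space measure_restrict_space)

lemma emeasure_cube_finite: "emeasure (cube_measure :: (real^'d::finite) measure) E < \<infinity>"
proof -
  have "emeasure cube_measure E \<le> emeasure cube_measure (space cube_measure :: (real^'d) set)"
    by (rule emeasure_space)
  also have "\<dots> = emeasure lborel (unit_cube :: (real^'d) set)"
    by (simp add: emeasure_restrict_space)
  also have "\<dots> < \<infinity>" using emeasure_lborel_cbox_finite by blast
  finally show ?thesis .
qed

text \<open>By convexity the image of the unit cube under z \<mapsto> (1 - r) x + r z stays inside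
  the unit cube, and it contains x. So no volume is lost when x lies on a face or at a
  corner.\<close>

lemma subcube:
  fixes x :: "real^'d::finite"
  assumes x: "x \<in> unit_cube" and r: "0 \<le> r" "r \<le> 1"
  obtains B where "B \<in> sets cube_measure" "B \<subseteq> unit_cube" "measure cube_measure B = r ^ CARD('d)"
    "\<And>y. y \<in> B \<Longrightarrow> infnorm (y - x) \<le> r"
proof
  define B :: "(real^'d) set" where "B = cbox ((1 - r) *\<^sub>R x) ((1 - r) *\<^sub>R x + r *\<^sub>R 1)"
  have x': "0 \<le> vec_nth x i" "vec_nth x i \<le> 1" for i
    using x by (auto simp: mem_box_cart)
  have xr: "r * vec_nth x i \<le> r" "0 \<le> r * vec_nth x i" "vec_nth x i - r * vec_nth x i \<ge> 0" 
    "vec_nth x i - r * vec_nth x i + r \<le> 1" for i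
  proof -
    have "(1 - r) * (1 - vec_nth x i) \<ge> 0" using x' r by simp
    then show "vec_nth x i - r * vec_nth x i + r \<le> 1" by (simp add: algebra_simps)
    have "(1 - r) * vec_nth x i \<ge> 0" using x' r by simp
    then show "vec_nth x i - r * vec_nth x i \<ge> 0" by (simp add: algebra_simps)
  qed (use x' r in \<open>auto simp: mult_left_le\<close>)
  show sub: "B \<subseteq> unit_cube"
  proof
    fix y assume "y \<in> B"
    then have "vec_nth x i - r * vec_nth x i \<le> vec_nth y i" "vec_nth y i \<le> vec_nth x i - r * vec_nth x i + r" for i
      by (auto simp: B_def mem_box_cart left_diff_distrib)
    then show "y \<in> unit_cube" using xr(3,4) unfolding mem_box_cart
      by (metis order_trans one_index zero_index)
  qed
  have B: "B \<in> sets lebesgue" by (simp add: B_def)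
  show "B \<in> sets cube_measure" by (rule cube_measure_subset(1)[OF B sub])
  have "(1 - r) *\<^sub>R x \<in> B" using r by (simp add: B_def mem_box_cart)
  then have ne: "B \<noteq> {}" by blast
  show "measure cube_measure B = r ^ CARD('d)"
    unfolding cube_measure_subset(2)[OF B sub]
    using content_cbox_cart[OF ne[unfolded B_def]] by (simp add: B_def)
  show "infnorm (y - x) \<le> r" if "y \<in> B" for y
  proof -
    have "\<bar>vec_nth (y - x) i\<bar> \<le> r" for i
    proof -
      have "(1 - r) * vec_nth x i \<le> vec_nth y i" "vec_nth y i \<le> (1 - r) * vec_nth x i + r"
        using that by (auto simp: B_def mem_box_cart)
      then show ?thesis using xr[of i] by (auto simp: abs_le_iff algebra_simps)
    qed
    then show ?thesis unfolding infnorm_cart by (intro cSup_least) auto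
  qed
qed

text \<open>Level sets replace the triangle inequality, which fails for \<open>p < 1\<close>.\<close>
lemma lipschitz_sup_bound:
  fixes u h1 h2 :: "real^'d::finite \<Rightarrow> real" and p :: ereal
  defines "q \<equiv> real_of_ereal (1 / p)" and "\<delta> \<equiv> real CARD('d) * real_of_ereal (1 / p)"
  assumes p: "0 < p" and h[measurable]: "h1 \<in> borel_measurable cube_measure" "h2 \<in> borel_measurable cube_measure"
    and K: "Lp_norm p h1 \<le> ennreal K" "Lp_norm p h2 \<le> ennreal K" "0 < K" "K \<le> M"
    and u: "\<And>x. x \<in> unit_cube \<Longrightarrow> u x = h1 x - h2 x"
    and lip: "\<And>x y. \<bar>u x - u y\<bar> \<le> M * infnorm (x - y)"
    and x: "x \<in> unit_cube"
  shows "\<bar>u x\<bar> \<le> 4 * 2 powr q * (K * M powr \<delta>) powr (1 / (1 + \<delta>))"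
proof (cases "u x = 0")
  case False
  \<comment> \<open>On the subcube below, u varies by at most a, so \<bar>u\<bar> stays at least 2 a
    there, and at every point h1 or h2 has absolute value at least a.\<close>
  define a where "a = \<bar>u x\<bar> / 4"
  have a: "0 < a" using False by (simp add: a_def)
  have M: "0 < M" using K by simp
  have q: "0 \<le> q" using p by (cases p) (auto simp: q_def one_ereal_def)
  have \<delta>: "\<delta> = real CARD('d) * q" "0 \<le> \<delta>" using q by (auto simp: \<delta>_def q_def)
  define r where "r = min 1 (a / M)"
  have r: "0 < r" "r \<le> 1" "r \<le> a / M" using a M by (auto simp: r_def)
  obtain B where B[measurable]: "B \<in> sets cube_measure" and Bc: "B \<subseteq> unit_cube" "measure cube_measure B = r ^ CARD('d)"
    "\<And>y. y \<in> B \<Longrightarrow> infnorm (y - x) \<le> r"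
    using subcube[OF x, of r] r by (metis less_imp_le)
  have ub: "2 * a \<le> \<bar>u y\<bar>" if "y \<in> B" for y
  proof -
    have "\<bar>u y - u x\<bar> \<le> M * infnorm (y - x)" by (rule lip)
    also have "\<dots> \<le> M * (a / M)" using Bc(3)[OF that] r M by (intro mult_left_mono) auto
    finally have "\<bar>u y - u x\<bar> \<le> a" using M by simp
    then show ?thesis unfolding a_def by linarith
  qed
  define E1 where "E1 = {y \<in> space cube_measure. y \<in> B \<and> a \<le> \<bar>h1 y\<bar>}"
  define E2 where "E2 = {y \<in> space cube_measure. y \<in> B \<and> a \<le> \<bar>h2 y\<bar>}"
  have E[measurable]: "E1 \<in> sets cube_measure" "E2 \<in> sets cube_measure" unfolding E1_def E2_def by measurable
  have BE: "B \<subseteq> E1 \<union> E2"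
  proof
    fix y assume y: "y \<in> B"
    then have "2 * a \<le> \<bar>h1 y - h2 y\<bar>" using ub[OF y] u[of y] Bc(1) by auto
    then show "y \<in> E1 \<union> E2" using y Bc(1) by (auto simp: E1_def E2_def)
  qed
  \<comment> \<open>E1 and E2 cover B, so one of them has at least half of its volume.\<close>
  define m where "m = r ^ CARD('d) / 2"
  have m: "0 < m" using r by (simp add: m_def)
  have "measure cube_measure B \<le> measure cube_measure (E1 \<union> E2)"
    using BE emeasure_cube_finite by (intro measure_mono_fmeasurable) (auto simp: fmeasurable_def)
  also have "\<dots> \<le> measure cube_measure E1 + measure cube_measure E2"
    by (rule measure_Un_le) auto
  finally have "m \<le> measure cube_measure E1 \<or> m \<le> measure cube_measure E2" by (auto simp: m_def Bc)
  then have amK: "a * m powr q \<le> K"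
  proof
    assume *: "m \<le> measure cube_measure E1"
    have "a * m powr q \<le> a * measure cube_measure E1 powr q"
      using a q m * by (intro mult_left_mono powr_mono2) auto
    also have "\<dots> \<le> K" unfolding q_def
      by (rule Lp_norm_level_set[OF p h(1) K(1)]) (use a K m * E(1) in \<open>auto simp: E1_def\<close>)
    finally show ?thesis .
  next
    assume *: "m \<le> measure cube_measure E2"
    have "a * m powr q \<le> a * measure cube_measure E2 powr q"
      using a q m * by (intro mult_left_mono powr_mono2) auto
    also have "\<dots> \<le> K" unfolding q_def
      by (rule Lp_norm_level_set[OF p h(2) K(2)]) (use a K m * E(2) in \<open>auto simp: E2_def\<close>)
    finally show ?thesis .
  qed
  have "m powr q = r powr \<delta> / 2 powr q"
    using r unfolding m_def by (simp add: powr_divide powr_realpow[symmetric] powr_powr \<delta>)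
  with amK have arK: "a * r powr \<delta> \<le> 2 powr q * K" by (simp add: field_simps)
  \<comment> \<open>If the radius is a / M, the level-set estimate has the required form. If it is
    capped at 1, only a \<le> 2 powr q * K is known, and K \<le> M brings in the power of M. The
    constant is chosen to fit both cases.\<close>
  have "a powr (1 + \<delta>) \<le> 2 powr (q * (1 + \<delta>)) * (K * M powr \<delta>)"
  proof (cases "a \<le> M")
    case True
    then have "r = a / M" using M by (simp add: r_def)
    then have "a * (a powr \<delta> / M powr \<delta>) \<le> 2 powr q * K" using arK a M by (simp add: powr_divide)
    then have "a powr (1 + \<delta>) \<le> 2 powr q * K * M powr \<delta>"
      using a M by (simp add: powr_add field_simps)
    also have "\<dots> \<le> 2 powr (q * (1 + \<delta>)) * K * M powr \<delta>"
      using K q \<delta> by (intro mult_right_mono powr_mono) (auto simp: algebra_simps)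
    finally show ?thesis by (simp add: mult_ac)
  next
    case False
    then have "r = 1" using M by (simp add: r_def)
    then have "a powr (1 + \<delta>) \<le> (2 powr q * K) powr (1 + \<delta>)" using arK a \<delta> by (intro powr_mono2) auto
    also have "\<dots> = 2 powr (q * (1 + \<delta>)) * (K * K powr \<delta>)"
      using K by (simp add: powr_mult powr_powr powr_add distrib_left)
    also have "\<dots> \<le> 2 powr (q * (1 + \<delta>)) * (K * M powr \<delta>)"
      using K \<delta> by (intro mult_left_mono powr_mono2) auto
    finally show ?thesis .
  qed
  then have "(a powr (1 + \<delta>)) powr (1 / (1 + \<delta>)) \<le> (2 powr (q * (1 + \<delta>)) * (K * M powr \<delta>)) powr (1 / (1 + \<delta>))"
    using \<delta> by (intro powr_mono2) auto
  also have "\<dots> = 2 powr q * (K * M powr \<delta>) powr (1 / (1 + \<delta>))"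
    using K M \<delta> by (simp add: powr_mult powr_powr)
  finally show ?thesis using a \<delta> by (simp add: powr_powr a_def)
qed (use K in simp)

text \<open>On a level set of h with positive measure, uniform closeness keeps \<bar>h'\<bar>
  bounded below, which contradicts a small L^p norm of h'. Mixing the two kinds of smallness avoids
  adding functions in L^p.\<close>

lemma Lp_limit_AE_zero:
  fixes h :: "real^'d::finite \<Rightarrow> real"
  assumes p: "0 < p" and h[measurable]: "h \<in> borel_measurable cube_measure"
    and approx: "\<And>e. e > 0 \<Longrightarrow> \<exists>h'\<in>borel_measurable cube_measure. Lp_norm p h' \<le> ennreal e \<and>
       (\<forall>x\<in>unit_cube. \<bar>h x - h' x\<bar> \<le> e)"
  shows "AE x in cube_measure. h x = 0"
proof -
  have "AE x in cube_measure. \<bar>h x\<bar> \<le> 2 / Suc k" for k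
  proof -
    define a :: real where "a = 1 / Suc k"
    have a: "a > 0" by (simp add: a_def)
    define E where "E = {x \<in> space cube_measure. 2 * a < \<bar>h x\<bar>}"
    have E[measurable]: "E \<in> sets cube_measure" unfolding E_def by measurable
    have "measure cube_measure E = 0"
    proof (rule ccontr)
      assume "measure cube_measure E \<noteq> 0"
      then have pos: "measure cube_measure E > 0" using measure_nonneg[of cube_measure E] by linarith
      define c where "c = a * measure cube_measure E powr real_of_ereal (1 / p)"
      have c: "c > 0" using a pos by (simp add: c_def)
      \<comment> \<open>e \<le> a transfers the lower bound from h to h'; e < c contradicts Markov's
        inequality on E.\<close>
      define e where "e = min a (c / 2)"
      have e: "e > 0" "e \<le> a" "e < c" using a c by (auto simp: e_def min_def)
      obtain h' where h': "h' \<in> borel_measurable cube_measure" "Lp_norm p h' \<le> ennreal e"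
         "\<forall>x\<in>unit_cube. \<bar>h x - h' x\<bar> \<le> e" using approx[OF e(1)] by auto
      have "c \<le> e" unfolding c_def
      proof (rule Lp_norm_level_set[OF p h'(1,2)])
        show "a \<le> \<bar>h' x\<bar>" if "x \<in> E" for x
        proof -
          have "2 * a < \<bar>h x\<bar>" "\<bar>h x - h' x\<bar> \<le> e" using that h'(3) by (auto simp: E_def)
          then show ?thesis using e(2) by linarith
        qed
      qed (use e a pos E in auto)
      then show False using e by simp
    qed
    moreover have "emeasure cube_measure E < \<infinity>" by (rule emeasure_cube_finite)
    ultimately have "E \<in> null_sets cube_measure" by (auto simp: null_sets_def measure_def enn2real_eq_0_iff)
    then show ?thesis by (rule AE_I') (auto simp: E_def a_def not_le)
  qed
  then have "AE x in cube_measure. \<forall>k. \<bar>h x\<bar> \<le> 2 / Suc k" by (simp add: AE_all_countable)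
  then show ?thesis
  proof eventually_elim
    case (elim x)
    have "(\<lambda>k. 2 / real (Suc k)) \<longlonglongrightarrow> 0" by real_asymp
    then have "\<bar>h x\<bar> \<le> 0" by (rule LIMSEQ_le_const) (use elim in auto)
    then show ?case by simp
  qed
qed

text \<open>Every point of the cube, including the boundary points, has arbitrarily small subcubes
  of positive measure nearby.\<close>

lemma continuous_AE_zero:
  fixes u :: "real^'d::finite \<Rightarrow> real"
  assumes "continuous_on unit_cube u" "AE x in cube_measure. u x = 0" "x \<in> unit_cube"
  shows "u x = 0"
proof (rule ccontr)
  assume "u x \<noteq> 0"
  then obtain e where e: "e > 0" "\<And>y. y \<in> unit_cube \<Longrightarrow> dist y x < e \<Longrightarrow> dist (u y) (u x) < \<bar>u x\<bar>"
    using assms(1,3) unfolding continuous_on_iff by (metis zero_less_abs_iff)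
  \<comment> \<open>The root of the dimension compares the Euclidean norm with the maximum norm; the
    factor 2 makes the distance strictly less than e.\<close>
  define r where "r = min 1 (e / (2 * sqrt (DIM(real^'d))))"
  have r: "0 < r" "r \<le> 1" using e by (auto simp: r_def)
  obtain B where B: "B \<in> sets cube_measure" "B \<subseteq> unit_cube" "measure cube_measure B = r ^ CARD('d)"
    "\<And>y. y \<in> B \<Longrightarrow> infnorm (y - x) \<le> r"
    using subcube[OF assms(3), of r] r by (metis less_imp_le)
  have "u y \<noteq> 0" if "y \<in> B" for y
  proof -
    have "norm (y - x) \<le> sqrt (DIM(real^'d)) * infnorm (y - x)" by (rule norm_le_infnorm)
    also have "\<dots> \<le> sqrt (DIM(real^'d)) * (e / (2 * sqrt (DIM(real^'d))))"
      using B(4)[OF that] by (intro mult_left_mono) (auto simp: r_def)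
    also have "\<dots> < e" using e by simp
    finally have "dist (u y) (u x) < \<bar>u x\<bar>" using that B(2) by (intro e(2)) (auto simp: dist_norm)
    then show ?thesis by (auto simp: dist_real_def)
  qed
  then have "AE x in cube_measure. x \<notin> B" using assms(2) by (auto elim: eventually_mono)
  then have "B \<in> null_sets cube_measure" using AE_iff_null_sets[OF B(1)] by simp
  then show False using B(3) r by (simp add: measure_def null_sets_def)
qed

text \<open>One real constant controls values and increments at every point of the cube, so that
  series and rescalings can be treated without extended reals or essential suprema. The price is a
  factor 2 in \<open>hoelder_norm\<close>.\<close>

definition hoelder_bounded :: "real \<Rightarrow> real \<Rightarrow> (real^'d::finite \<Rightarrow> real) \<Rightarrow> bool" where
  "hoelder_bounded \<beta> K g \<longleftrightarrow> (\<forall>x\<in>unit_cube. \<bar>g x\<bar> \<le> K) \<and>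
     (\<forall>x\<in>unit_cube. \<forall>y\<in>unit_cube. \<bar>g x - g y\<bar> \<le> K * infnorm (x - y) powr \<beta>)"

section \<open>Continuity, measurability and norms of Hoelder functions\<close>

lemma hoelder_continuous_on:
  fixes g :: "real^'d::finite \<Rightarrow> real"
  assumes "\<beta> > 0" "\<And>x y. x \<in> S \<Longrightarrow> y \<in> S \<Longrightarrow> \<bar>g x - g y\<bar> \<le> K * infnorm (x - y) powr \<beta>"
  shows "continuous_on S g"
proof -
  have "(g \<longlongrightarrow> g x) (at x within S)" if x: "x \<in> S" for x
  proof (rule Lim_null[THEN iffD2], rule Lim_null_comparison)
    show "\<forall>\<^sub>F y in at x within S. norm (g y - g x) \<le> \<bar>K\<bar> * norm (y - x) powr \<beta>"
      unfolding eventually_at_filter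
    proof (rule always_eventually, safe)
      fix y assume y: "y \<in> S"
      have "norm (g y - g x) \<le> K * infnorm (y - x) powr \<beta>" using assms(2)[OF y x] by simp
      also have "\<dots> \<le> \<bar>K\<bar> * norm (y - x) powr \<beta>"
        using assms(1) by (intro mult_mono powr_mono2) (auto simp: infnorm_pos_le infnorm_le_norm)
      finally show "norm (g y - g x) \<le> \<bar>K\<bar> * norm (y - x) powr \<beta>" .
    qed
    have "((\<lambda>y. norm (y - x) powr \<beta>) \<longlongrightarrow> 0 powr \<beta>) (at x within S)"
    proof (rule tendsto_powr'[OF _ tendsto_const])
      have "((\<lambda>y. norm (y - x)) \<longlongrightarrow> norm (x - x)) (at x within S)" by (intro tendsto_intros)
      then show "((\<lambda>y. norm (y - x)) \<longlongrightarrow> 0) (at x within S)" by simp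
    qed (use assms(1) in auto)
    from tendsto_mult[OF tendsto_const this, of "\<bar>K\<bar>"] assms(1)
    show "((\<lambda>y. \<bar>K\<bar> * norm (y - x) powr \<beta>) \<longlongrightarrow> 0) (at x within S)" by simp
  qed
  then show ?thesis by (simp add: continuous_on_def)
qed

lemma hoelder_bounded_continuous_on:
  "hoelder_bounded \<beta> K g \<Longrightarrow> \<beta> > 0 \<Longrightarrow> continuous_on unit_cube g"
  unfolding hoelder_bounded_def by (intro hoelder_continuous_on[of \<beta> _ _ K]) auto

lemma continuous_on_cube_measurable:
  "continuous_on unit_cube g \<Longrightarrow> (g :: real^'d::finite \<Rightarrow> real) \<in> borel_measurable cube_measure"
  by (intro continuous_imp_measurable_on_sets_lebesgue) auto

lemma lipschitz_continuous_on:
  fixes g :: "real^'d::finite \<Rightarrow> real"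
  assumes "\<And>x y. \<bar>g x - g y\<bar> \<le> K * infnorm (x - y)"
  shows "continuous_on S g"
  using assms by (intro hoelder_continuous_on[of 1 _ _ K]) (auto simp: infnorm_pos_le)

lemma hoelder_norm_le:
  fixes g :: "real^'d::finite \<Rightarrow> real"
  assumes g: "hoelder_bounded \<beta> K g" and "\<beta> > 0"
  shows "hoelder_norm \<beta> g \<le> ennreal (2 * K)"
proof -
  have "0 \<in> (unit_cube :: (real^'d) set)" by (auto simp: mem_box_cart)
  then have K: "0 \<le> K" using g unfolding hoelder_bounded_def by (meson abs_ge_zero order_trans)
  have [measurable]: "g \<in> borel_measurable cube_measure"
    by (rule continuous_on_cube_measurable[OF hoelder_bounded_continuous_on[OF g assms(2)]])
  have "Lp_norm \<infinity> g \<le> ennreal K"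
    unfolding Lp_norm_def using g by (auto simp: hoelder_bounded_def intro!: esssup_I AE_I2 ennreal_leI)
  moreover have "Lip \<beta> g \<le> ennreal K"
    unfolding Lip_def
  proof (rule SUP_least, clarify)
    fix x y :: "real^'d" assume xy: "x \<in> unit_cube" "y \<in> unit_cube" "x \<noteq> y"
    then have "infnorm (x - y) > 0" by (simp add: infnorm_pos_lt)
    then show "ennreal (\<bar>g x - g y\<bar> / infnorm (x - y) powr \<beta>) \<le> ennreal K"
      using g xy by (intro ennreal_leI) (auto simp: hoelder_bounded_def field_simps)
  qed
  ultimately have "hoelder_norm \<beta> g \<le> ennreal K + ennreal K"
    unfolding hoelder_norm_def by (rule add_mono)
  then show ?thesis using K by (simp flip: ennreal_plus)
qed

lemma hoelder_norm_leD:
  fixes g :: "real^'d::finite \<Rightarrow> real"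
  assumes "hoelder_norm \<beta> g \<le> ennreal K" "0 \<le> K" "x \<in> unit_cube" "y \<in> unit_cube"
  shows "\<bar>g x - g y\<bar> \<le> K * infnorm (x - y) powr \<beta>"
proof (cases "x = y")
  case False
  then have pos: "infnorm (x - y) powr \<beta> > 0" using infnorm_pos_lt[of "x - y"] by simp
  have "ennreal (\<bar>g x - g y\<bar> / infnorm (x - y) powr \<beta>) \<le> Lip \<beta> g"
    unfolding Lip_def by (rule SUP_upper2[of "(x, y)"]) (use False assms in auto)
  also have "\<dots> \<le> hoelder_norm \<beta> g" by (simp add: hoelder_norm_def)
  also have "\<dots> \<le> ennreal K" by fact
  finally show ?thesis using pos assms(2) by (simp add: field_simps)
qed (use assms in simp)

section \<open>Networks of maximal slope\<close>

text \<open>Such a layer sees its input only through the sum of the coordinates and returns a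
  constant vector, so composing these layers is a computation with scalars.\<close>

definition const_layer :: "nat \<Rightarrow> nat \<Rightarrow> real \<Rightarrow> real \<Rightarrow> real mat \<times> real Matrix.vec" where
  "const_layer m k a b = (mat m k (\<lambda>_. a), Matrix.vec m (\<lambda>_. b))"

text \<open>Each pair of layers fans a number out to N copies and sums them again, which multiplies
  it by N a^2 at the cost of 2 N weights. The width is thus gained once per two layers, as in the
  upper bound. The empty list is no network, but \<open>realization\<close> treats it as the
  identity, which serves as the base case.\<close>

fun amplifier :: "nat \<Rightarrow> real \<Rightarrow> nat \<Rightarrow> network" where
  "amplifier N a 0 = []"
| "amplifier N a (Suc k) = const_layer N 1 a 0 # const_layer 1 N a 0 # amplifier N a k"

lemma const_layer_apply:
  assumes "dim_vec v = k"
  shows "fst (const_layer m k a b) *\<^sub>v v + snd (const_layer m k a b)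
    = Matrix.vec m (\<lambda>_. a * (\<Sum>i<k. vec_index v i) + b)"
  using assms
  by (intro eq_vecI) (auto simp: const_layer_def scalar_prod_def sum_distrib_left atLeast0LessThan)

text \<open>The last layer carries no activation, but the ReLU fixes non-negative numbers. On such
  values inner and last layers obey the same equation, with the empty list as the identity.\<close>

lemma realization_Cons_const_layer:
  assumes "dim_vec v = k" and "\<Phi> \<noteq> [] \<or> 0 \<le> a * (\<Sum>i<k. vec_index v i) + b"
  shows "realization (const_layer m k a b # \<Phi>) v =
    realization \<Phi> (Matrix.vec m (\<lambda>_. relu (a * (\<Sum>i<k. vec_index v i) + b)))"
proof (cases \<Phi>)
  case Nil
  then show ?thesis
    using const_layer_apply[OF assms(1), of m a b] assms(2)
    by (auto simp: const_layer_def relu_def)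
next
  case (Cons l \<Psi>)
  then show ?thesis
    using const_layer_apply[OF assms(1), of m a b]
    by (auto simp: const_layer_def map_vec o_def)
qed

lemma realization_amplifier:
  assumes "0 \<le> a" "0 \<le> v"
  shows "realization (amplifier N a k) (Matrix.vec 1 (\<lambda>_. v)) = Matrix.vec 1 (\<lambda>_. (real N * a\<^sup>2) ^ k * v)"
  using assms(2)
proof (induction k arbitrary: v)
  case (Suc k)
  have "realization (amplifier N a (Suc k)) (Matrix.vec 1 (\<lambda>_. v)) =
        realization (amplifier N a k) (Matrix.vec 1 (\<lambda>_. real N * a\<^sup>2 * v))"
    using assms(1) Suc.prems
    by (simp add: realization_Cons_const_layer relu_def power2_eq_square mult_ac del: One_nat_def)
  also have "\<dots> = Matrix.vec 1 (\<lambda>_. (real N * a\<^sup>2) ^ Suc k * v)"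
    using Suc.IH[of "real N * a\<^sup>2 * v"] Suc.prems by (simp add: mult_ac)
  finally show ?case .
qed simp

section \<open>Depth, dimensions and weights of amplifiers\<close>

lemma length_amplifier [simp]: "length (amplifier N a k) = 2 * k"
  by (induction k) auto

lemma is_network_const_layer_Cons:
  assumes "m \<ge> 1" "k \<ge> 1" "\<Phi> = [] \<or> is_network \<Phi> \<and> d_in \<Phi> = m"
  shows "is_network (const_layer m k a b # \<Phi>)"
  using assms by (cases \<Phi>) (auto simp: const_layer_def is_network_Cons, auto simp: is_network_def)

lemma d_in_const_layer_Cons [simp]: "d_in (const_layer m k a b # \<Phi>) = k"
  by (simp add: d_in_def const_layer_def)

lemma d_out_const_layer_Cons [simp]:
  "d_out (const_layer m k a b # \<Phi>) = (if \<Phi> = [] then m else d_out \<Phi>)"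
  by (simp add: d_out_def const_layer_def)

lemma amplifier_network:
  assumes "N \<ge> 1"
  shows "amplifier N a k = [] \<or> is_network (amplifier N a k) \<and> d_in (amplifier N a k) = 1 \<and> d_out (amplifier N a k) = 1"
  using assms
  by (induction k) (auto intro!: is_network_const_layer_Cons simp del: One_nat_def)

lemma num_weights_const_layer_Cons:
  "num_weights (const_layer m k a b # \<Phi>) \<le> m * k + (if b = 0 then 0 else m) + num_weights \<Phi>"
proof -
  have "mat_l0 (mat m k (\<lambda>_. a)) \<le> card ({..<m} \<times> {..<k})"
    unfolding mat_l0_def by (intro card_mono) auto
  moreover have "vec_l0 (Matrix.vec m (\<lambda>_. b)) \<le> card (if b = 0 then {} else {..<m})"
    unfolding vec_l0_def by (intro card_mono) auto
  ultimately show ?thesis by (auto simp: num_weights_def const_layer_def)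
qed

lemma num_weights_amplifier: "num_weights (amplifier N a k) \<le> 2 * N * k"
proof (induction k)
  case (Suc k)
  have "num_weights (amplifier N a (Suc k)) \<le> N + num_weights (const_layer 1 N a 0 # amplifier N a k)"
    using num_weights_const_layer_Cons[of N 1 a 0 "const_layer 1 N a 0 # amplifier N a k"] by simp
  also have "\<dots> \<le> N + (N + num_weights (amplifier N a k))"
    using num_weights_const_layer_Cons[of 1 N a 0 "amplifier N a k"] by simp
  finally show ?case using Suc by simp
qed (simp add: num_weights_def)

text \<open>Positive dimensions make the sets of entries nonempty, so that the maxima in
  \<open>weight_norm\<close> are \<bar>a\<bar> and \<bar>b\<bar>.\<close>

definition bounded_layer :: "real \<Rightarrow> real mat \<times> real Matrix.vec \<Rightarrow> bool" where
  "bounded_layer C l \<longleftrightarrow> (\<exists>m k a b. m \<ge> 1 \<and> k \<ge> 1 \<and> \<bar>a\<bar> \<le> C \<and> \<bar>b\<bar> \<le> C \<and> l = const_layer m k a b)"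

lemma bounded_layerI:
  "m \<ge> 1 \<Longrightarrow> k \<ge> 1 \<Longrightarrow> \<bar>a\<bar> \<le> C \<Longrightarrow> \<bar>b\<bar> \<le> C \<Longrightarrow> bounded_layer C (const_layer m k a b)"
  unfolding bounded_layer_def by blast

lemma weight_norm_const_layers:
  assumes "\<Phi> \<noteq> []" "\<And>l. l \<in> set \<Phi> \<Longrightarrow> bounded_layer C l"
  shows "weight_norm \<Phi> \<le> C"
  unfolding weight_norm_def
proof (rule Max.boundedI)
  fix z assume "z \<in> (\<lambda>(A, b). max (mat_linf A) (vec_linf b)) ` set \<Phi>"
  then obtain A v where Av: "(A, v) \<in> set \<Phi>" "z = max (mat_linf A) (vec_linf v)" by auto
  obtain m k a b where *: "m \<ge> 1" "k \<ge> 1" "\<bar>a\<bar> \<le> C" "\<bar>b\<bar> \<le> C" and "(A, v) = const_layer m k a b"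
    using assms(2)[OF Av(1)] unfolding bounded_layer_def by blast
  then have z: "z = max (mat_linf (mat m k (\<lambda>_. a))) (vec_linf (Matrix.vec m (\<lambda>_. b)))"
    using Av(2) by (simp add: const_layer_def)
  have "elements_mat (mat m k (\<lambda>_. a)) = {a}"
  proof (intro antisym subsetI)
    fix x assume "x \<in> elements_mat (mat m k (\<lambda>_. a))"
    then show "x \<in> {a}" using elements_matD by fastforce
  next
    fix x assume "x \<in> {a}"
    then show "x \<in> elements_mat (mat m k (\<lambda>_. a))"
      using * by (intro elements_matI[of _ m k 0 0]) auto
  qed
  moreover have "vec_set (Matrix.vec m (\<lambda>_. b)) = {b}"
  proof (intro antisym subsetI)
    fix x assume "x \<in> vec_set (Matrix.vec m (\<lambda>_. b))"
    then show "x \<in> {b}" by (auto simp: vec_set_def)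
  next
    fix x assume "x \<in> {b}"
    then show "x \<in> vec_set (Matrix.vec m (\<lambda>_. b))"
      using * by (intro vec_setI[of _ 0]) auto
  qed
  ultimately show "z \<le> C" using * by (simp add: z mat_linf_def vec_linf_def)
qed (use assms in auto)

lemma bounded_amplifier_layers:
  assumes "N \<ge> 1" "\<bar>a\<bar> \<le> C" "l \<in> set (amplifier N a k)"
  shows "bounded_layer C l"
  using assms(3)
proof (induction k)
  case (Suc k)
  have "0 \<le> C" using assms(2) by linarith
  then have "bounded_layer C (const_layer N 1 a 0)" "bounded_layer C (const_layer 1 N a 0)"
    using assms(1,2) by (auto intro!: bounded_layerI simp del: One_nat_def)
  then show ?case using Suc by (auto simp del: One_nat_def)
qed simp

text \<open>Every layer contributes one factor C to the slope, the first one inside the ReLU, and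
  every pair of fan-out and fan-in contributes one factor N. The slope along a coordinate axis is
  C^L N^(L div 2), the upper Lipschitz bound with N in place of n and without the factor d.\<close>

lemma nn_class_ridge:
  assumes L: "L \<ge> 2" "enat L \<le> \<l> n" and c: "c n = enat C"
    and b: "0 \<le> b" "b \<le> real C" and N: "N \<ge> 1" "(CARD('d) + 2) * N * L \<le> n"
  shows "(\<lambda>x::real^'d::finite. real C ^ (L - 1) * real N ^ (L div 2) * relu (b - real C * (\<Sum>i\<in>UNIV. vec_nth x i)))
           \<in> nn_class \<l> c n"
proof -
  define d where "d = CARD('d)"
  have d: "d \<ge> 1" by (simp add: d_def Suc_le_eq)
  have sum: "(\<Sum>i<d. vec_index (input_vec x) i) = (\<Sum>i\<in>UNIV. vec_nth x i)" for x :: "real^'d"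
    using sum_input_vec[of "\<lambda>a b. a" x x] by (simp add: d_def)
  have dim: "dim_vec (input_vec x) = d" for x :: "real^'d" by (simp add: input_vec_def d_def)
  \<comment> \<open>For even L the first layer itself fans out and the second fans in, which leaves
    k = L div 2 - 1 further pairs. For odd L the first layer has one unit and k = L div 2 pairs
    follow.\<close>
  define k where "k = (L - 1) div 2"
  define \<Phi> where "\<Phi> = (if even L then const_layer N d (- real C) b # const_layer 1 N (real C) 0 # amplifier N (real C) k
     else const_layer 1 d (- real C) b # amplifier N (real C) k)"
  have len: "length \<Phi> = L" using L(1) by (auto simp: \<Phi>_def k_def elim!: evenE oddE)
  \<comment> \<open>An odd L is at least 3. If the amplifier were empty, the first layer would be
    the last one and its ReLU would be missing.\<close>
  have odd: "amplifier N (real C) k \<noteq> []" if "odd L"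
  proof -
    have "k > 0" using that L(1) by (auto simp: k_def elim!: oddE)
    then show ?thesis by (cases k) auto
  qed
  have net: "is_network \<Phi>" "d_in \<Phi> = d" "d_out \<Phi> = 1"
    using amplifier_network[OF N(1), of "real C" k] N(1) d odd
    by (auto simp: \<Phi>_def intro!: is_network_const_layer_Cons simp del: One_nat_def)
  have nw: "num_weights \<Phi> \<le> n"
  proof (cases "even L")
    case True
    then have Lk: "L = 2 * k + 2" using L(1) by (auto simp: k_def elim!: evenE)
    have "num_weights \<Phi> \<le> N * d + N + num_weights (const_layer 1 N (real C) 0 # amplifier N (real C) k)"
      using num_weights_const_layer_Cons[of N d "- real C" b "const_layer 1 N (real C) 0 # amplifier N (real C) k"] True
      by (simp add: \<Phi>_def split: if_splits)
    also have "\<dots> \<le> N * d + N + (N + 2 * N * k)"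
      using num_weights_const_layer_Cons[of 1 N "real C" 0 "amplifier N (real C) k"]
        num_weights_amplifier[of N "real C" k] by simp
    also have "\<dots> \<le> (d + 2) * N * L" by (simp add: Lk algebra_simps)
    finally show ?thesis using N(2) by (simp add: d_def)
  next
    case False
    then have Lk: "L = 2 * k + 1" using L(1) by (auto simp: k_def elim!: oddE)
    have "num_weights \<Phi> \<le> d + 1 + num_weights (amplifier N (real C) k)"
      using num_weights_const_layer_Cons[of 1 d "- real C" b "amplifier N (real C) k"] False
      by (simp add: \<Phi>_def split: if_splits)
    also have "\<dots> \<le> d + 1 + 2 * N * k"
      using num_weights_amplifier[of N "real C" k] by simp
    also have "\<dots> \<le> (d + 1) * N + 2 * N * k"
      using mult_le_mono2[OF N(1), of "d + 1"] by simp
    also have "\<dots> \<le> (d + 2) * N * L" by (simp add: Lk algebra_simps)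
    finally show ?thesis using N(2) by (simp add: d_def)
  qed
  have wn: "weight_norm \<Phi> \<le> real C"
  proof (rule weight_norm_const_layers)
    show "\<Phi> \<noteq> []" using len L by auto
    fix l assume "l \<in> set \<Phi>"
    then consider "l = const_layer N d (- real C) b" | "l = const_layer 1 N (real C) 0"
      | "l = const_layer 1 d (- real C) b" | "l \<in> set (amplifier N (real C) k)"
      by (auto simp: \<Phi>_def split: if_splits)
    then show "bounded_layer (real C) l"
    proof cases
      case 4
      then show ?thesis by (intro bounded_amplifier_layers[OF N(1) _ 4]) simp
    qed (use N(1) d b in \<open>auto intro!: bounded_layerI\<close>)
  qed
  have val: "realization \<Phi> (input_vec x) =
    Matrix.vec 1 (\<lambda>_. real C ^ (L - 1) * real N ^ (L div 2) * relu (b - real C * (\<Sum>i\<in>UNIV. vec_nth x i)))" for x :: "real^'d"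
  proof -
    define v where "v = relu (b - real C * (\<Sum>i\<in>UNIV. vec_nth x i))"
    have v: "0 \<le> v" by (simp add: v_def relu_def)
    have 1: "realization (const_layer m d (- real C) b # \<Psi>) (input_vec x) = realization \<Psi> (Matrix.vec m (\<lambda>_. v))"
      if "\<Psi> \<noteq> []" for m \<Psi>
      using that realization_Cons_const_layer[of "input_vec x" d \<Psi> "- real C" b m]
      by (simp add: dim sum v_def)
    have sq: "(real N * (real C)\<^sup>2) ^ k = real C ^ (k + k) * real N ^ k"
      by (simp add: power_mult_distrib power_add power2_eq_square)
    show ?thesis
    proof (cases "even L")
      case True
      then have "L = 2 * k + 2" using L(1) by (auto simp: k_def elim!: evenE)
      then have exps: "L - 1 = k + k + 1" "L div 2 = k + 1" by simp_all
      have "realization \<Phi> (input_vec x) = realization (amplifier N (real C) k) (Matrix.vec 1 (\<lambda>_. real N * real C * v))"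
        using True v by (simp add: \<Phi>_def 1 realization_Cons_const_layer relu_def mult_ac del: One_nat_def)
      also have "\<dots> = Matrix.vec 1 (\<lambda>_. (real N * (real C)\<^sup>2) ^ k * (real N * real C * v))"
        using v by (intro realization_amplifier) auto
      also have "(real N * (real C)\<^sup>2) ^ k * (real N * real C * v) = real C ^ (L - 1) * real N ^ (L div 2) * v"
        unfolding exps sq power_add by (simp only: power_one_right mult_ac)
      finally show ?thesis by (simp add: v_def)
    next
      case False
      then have "L = 2 * k + 1" using L(1) by (auto simp: k_def elim!: oddE)
      then have exps: "L - 1 = k + k" "L div 2 = k" by simp_all
      have "realization \<Phi> (input_vec x) = realization (amplifier N (real C) k) (Matrix.vec 1 (\<lambda>_. v))"
        using False odd by (simp add: \<Phi>_def 1 del: One_nat_def)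
      also have "\<dots> = Matrix.vec 1 (\<lambda>_. (real N * (real C)\<^sup>2) ^ k * v)"
        using v by (intro realization_amplifier) auto
      finally have "realization \<Phi> (input_vec x) = Matrix.vec 1 (\<lambda>_. (real N * (real C)\<^sup>2) ^ k * v)" .
      then show ?thesis by (simp only: exps v_def sq)
    qed
  qed
  show ?thesis
    unfolding nn_class_def
    by (rule CollectI, rule exI[of _ \<Phi>]) (use net nw wn L(2) c len in \<open>simp add: val d_def\<close>)
qed

section \<open>The zero function and monotonicity of the classes\<close>

lemma mat_l0_zero: "mat_l0 (mat m k (\<lambda>_. 0)) = 0"
proof -
  have "{(i, j). i < m \<and> j < k \<and> mat m k (\<lambda>_. 0 :: real) $$ (i, j) \<noteq> 0} = {}" by auto
  then show ?thesis unfolding mat_l0_def dim_row_mat dim_col_mat by (simp only: card.empty)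
qed

lemma vec_l0_zero: "vec_l0 (Matrix.vec m (\<lambda>_. 0)) = 0"
proof -
  have "{i. i < m \<and> vec_index (Matrix.vec m (\<lambda>_. 0 :: real)) i \<noteq> 0} = {}" by auto
  then show ?thesis unfolding vec_l0_def dim_vec by (simp only: card.empty)
qed

text \<open>Provides the competitor 0 for approximating a test function with fewer weights than it
  has.\<close>

lemma zero_in_nn_class:
  assumes "\<l> n \<ge> 1"
  shows "(\<lambda>x::real^'d::finite. 0) \<in> nn_class \<l> c n"
proof -
  define d where "d = CARD('d)"
  have d: "d \<ge> 1" by (simp add: d_def Suc_le_eq)
  define \<Phi> where "\<Phi> = [const_layer 1 d 0 0]"
  have dim: "dim_vec (input_vec x) = d" for x :: "real^'d" by (simp add: input_vec_def d_def)
  have "realization \<Phi> (input_vec x) = Matrix.vec 1 (\<lambda>_. 0)" for x :: "real^'d"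
    unfolding \<Phi>_def by (subst realization_Cons_const_layer) (auto simp: dim relu_def)
  moreover have "is_network \<Phi>" "d_in \<Phi> = d" "d_out \<Phi> = 1"
    unfolding \<Phi>_def using d by (auto intro!: is_network_const_layer_Cons)
  moreover have "num_weights \<Phi> = 0"
    by (simp add: \<Phi>_def num_weights_def const_layer_def mat_l0_zero vec_l0_zero)
  moreover have "weight_norm \<Phi> \<le> 0"
    using d by (intro weight_norm_const_layers) (auto simp: \<Phi>_def intro!: bounded_layerI)
  then have "ereal (weight_norm \<Phi>) \<le> ereal_of_enat (c n)"
    by (cases "c n") auto
  moreover have "enat (num_layers \<Phi>) \<le> \<l> n"
    using assms by (simp add: \<Phi>_def one_enat_def)
  ultimately show ?thesis
    unfolding nn_class_def d_def by (intro CollectI exI[of _ \<Phi>]) simp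
qed

lemma nn_class_mono:
  assumes "n \<le> m" "\<l> n \<le> \<l> m" "c n \<le> c m"
  shows "nn_class \<l> c n \<subseteq> nn_class \<l> c m"
  unfolding nn_class_def
proof clarify
  fix \<Phi> assume *: "is_network \<Phi>" "d_in \<Phi> = CARD('a)" "d_out \<Phi> = 1"
        "num_weights \<Phi> \<le> n" "enat (num_layers \<Phi>) \<le> \<l> n" "ereal (weight_norm \<Phi>) \<le> ereal_of_enat (c n)"
  have "ereal_of_enat (c n) \<le> ereal_of_enat (c m)" using assms(3) by simp
  then show "\<exists>\<Psi>. (\<lambda>x::real^'a. vec_index (realization \<Phi> (input_vec x)) 0) = (\<lambda>x. vec_index (realization \<Psi> (input_vec x)) 0) \<and>
       is_network \<Psi> \<and> d_in \<Psi> = CARD('a) \<and> d_out \<Psi> = 1 \<and> num_weights \<Psi> \<le> m \<and>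
       enat (num_layers \<Psi>) \<le> \<l> m \<and> ereal (weight_norm \<Psi>) \<le> ereal_of_enat (c m)"
    using * assms by (intro exI[of _ \<Phi>]) (auto intro: order_trans)
qed

section \<open>Sufficiency\<close>

text \<open>A power n^\<epsilon> absorbs the logarithm in each layer, so the exponent exceeds the
  ideal one by L \<epsilon> only. The parameter A0 allows the constant to be enlarged, which later
  keeps the Lipschitz bounds above the L^p bounds.\<close>

lemma nn_class_lipschitz_growth:
  fixes K2 :: real
  assumes l: "\<And>n. n \<ge> 1 \<Longrightarrow> \<l> n \<le> enat L" and c: "\<And>n. n \<ge> 1 \<Longrightarrow> c n \<ge> 1"
    and K2: "\<And>n. n \<ge> 1 \<Longrightarrow> ereal_of_enat (c n) \<le> ereal (K2 * real n powr \<theta> * ln (2 * real n) powr \<kappa>)"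
    and \<epsilon>: "\<epsilon> > 0"
  obtains A where "A \<ge> A0" "\<And>n (g :: real^'d::finite \<Rightarrow> real) x y. n \<ge> 1 \<Longrightarrow> g \<in> nn_class \<l> c n \<Longrightarrow>
      \<bar>g x - g y\<bar> \<le> A * real n powr (real L * (\<theta> + \<epsilon>) + real (L div 2)) * infnorm (x - y)"
proof -
  have "(\<lambda>n::nat. ln (2 * real n) powr \<kappa> / real n powr \<epsilon>) \<longlonglongrightarrow> 0" using \<epsilon> by real_asymp
  then have "Bseq (\<lambda>n::nat. ln (2 * real n) powr \<kappa> / real n powr \<epsilon>)"
    by (intro convergent_imp_Bseq convergentI)
  then obtain K0 where K0: "K0 > 0" "\<And>n. norm (ln (2 * real n) powr \<kappa> / real n powr \<epsilon>) \<le> K0"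
    unfolding Bseq_def by blast
  define K where "K = \<bar>K2\<bar> * K0"
  define \<gamma> where "\<gamma> = real L * (\<theta> + \<epsilon>) + real (L div 2)"
  define A where "A = max A0 (real CARD('d) * K ^ L)"
  have K: "K \<ge> 0" using K0 by (simp add: K_def)
  show thesis
  proof (rule that[of A])
    show "A \<ge> A0" by (simp add: A_def)
    fix n :: nat and g :: "real^'d \<Rightarrow> real" and x y
    assume n: "n \<ge> 1" and g: "g \<in> nn_class \<l> c n"
    obtain C where C: "c n = enat C" using K2[OF n] by (cases "c n") auto
    have C1: "C \<ge> 1" using c[OF n] C by (simp add: one_enat_def)
    have "real C \<le> K2 * real n powr \<theta> * ln (2 * real n) powr \<kappa>" using K2[OF n] C by simp
    also have "\<dots> \<le> \<bar>K2\<bar> * real n powr \<theta> * (K0 * real n powr \<epsilon>)"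
      using K0(2)[of n] n by (intro mult_mono) (auto simp: field_simps)
    also have "\<dots> = K * real n powr (\<theta> + \<epsilon>)" by (simp add: K_def powr_add)
    finally have CK: "real C \<le> K * real n powr (\<theta> + \<epsilon>)" .
    have "\<bar>g x - g y\<bar> \<le> real CARD('d) * real C ^ L * real n ^ (L div 2) * infnorm (x - y)"
      by (rule nn_class_lipschitz[OF g C C1 n l[OF n]])
    also have "\<dots> \<le> real CARD('d) * (K * real n powr (\<theta> + \<epsilon>)) ^ L * real n ^ (L div 2) * infnorm (x - y)"
      using CK by (intro mult_right_mono mult_left_mono power_mono) (auto simp: infnorm_pos_le)
    also have "\<dots> = (real CARD('d) * K ^ L) * real n powr \<gamma> * infnorm (x - y)"
    proof -
      have "(real n powr (\<theta> + \<epsilon>)) ^ L = real n powr (real L * (\<theta> + \<epsilon>))"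
        using n by (simp add: powr_realpow[symmetric] powr_powr mult.commute)
      moreover have "real n ^ (L div 2) = real n powr real (L div 2)"
        using n by (simp add: powr_realpow)
      ultimately show ?thesis by (simp add: power_mult_distrib \<gamma>_def powr_add)
    qed
    also have "\<dots> \<le> A * real n powr \<gamma> * infnorm (x - y)"
      by (intro mult_right_mono) (auto simp: A_def infnorm_pos_le)
    finally show "\<bar>g x - g y\<bar> \<le> A * real n powr (real L * (\<theta> + \<epsilon>) + real (L div 2)) * infnorm (x - y)"
      by (simp add: \<gamma>_def)
  qed
qed

text \<open>The Weierstrass test, applied to values and to increments, makes the sum a Hoelder
  function. It represents f since f minus a partial sum is small in L^p while the remaining tail is
  uniformly small.\<close>

lemma telescoping_hoelder:
  fixes f :: "real^'d::finite \<Rightarrow> real" and u :: "nat \<Rightarrow> real^'d \<Rightarrow> real"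
  assumes p: "0 < p" and \<beta>: "\<beta> > 0" and f[measurable]: "f \<in> borel_measurable cube_measure"
    and G[measurable]: "\<And>j. (\<lambda>x. \<Sum>i\<le>j. u i x) \<in> borel_measurable cube_measure"
    and S: "summable S" "\<And>j x. x \<in> unit_cube \<Longrightarrow> \<bar>u j x\<bar> \<le> S j"
    and T: "summable T" "\<And>j x y. x \<in> unit_cube \<Longrightarrow> y \<in> unit_cube \<Longrightarrow> \<bar>u j x - u j y\<bar> \<le> T j * infnorm (x - y) powr \<beta>"
    and K: "\<And>j. Lp_norm p (\<lambda>x. f x - (\<Sum>i\<le>j. u i x)) \<le> ennreal (K j)" "K \<longlonglongrightarrow> 0"
  shows "hoelder_bounded \<beta> (suminf S + suminf T) (\<lambda>x. \<Sum>j. u j x)" (is "hoelder_bounded _ _ ?g")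
    and "AE x in cube_measure. f x = (\<Sum>j. u j x)"
proof -
  have "0 \<in> (unit_cube :: (real^'d) set)" by (auto simp: mem_box_cart)
  then have S0: "0 \<le> S j" for j using S(2)[of 0 j] by (meson abs_ge_zero order_trans)
  have one: "infnorm (1::real^'d) = 1"
    by (simp add: infnorm_cart)
  have T0: "0 \<le> T j" for j
  proof -
    \<comment> \<open>Opposite corners are at maximum distance 1, so the bound there reads off the
      sign of T j.\<close>
    have "\<bar>u j 1 - u j 0\<bar> \<le> T j * infnorm (1 - 0 :: real^'d) powr \<beta>"
      by (intro T) (auto simp: mem_box_cart)
    then show ?thesis using one by simp
  qed
  have sum_abs: "summable (\<lambda>j. \<bar>u j x\<bar>)" if "x \<in> unit_cube" for x
    by (rule summable_comparison_test'[OF S(1), of 0]) (simp add: S(2)[OF that])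
  have sum: "summable (\<lambda>j. u j x)" if "x \<in> unit_cube" for x
    by (rule summable_rabs_cancel[OF sum_abs[OF that]])
  show hb: "hoelder_bounded \<beta> (suminf S + suminf T) ?g"
    unfolding hoelder_bounded_def
  proof safe
    fix x :: "real^'d" assume x: "x \<in> unit_cube"
    have "\<bar>?g x\<bar> \<le> (\<Sum>j. \<bar>u j x\<bar>)" using summable_rabs[OF sum_abs[OF x]] .
    also have "\<dots> \<le> suminf S" by (rule suminf_le[OF S(2)[OF x] sum_abs[OF x] S(1)])
    finally show "\<bar>?g x\<bar> \<le> suminf S + suminf T" using suminf_nonneg[OF T(1) T0] by linarith
    fix y :: "real^'d" assume y: "y \<in> unit_cube"
    have sT: "summable (\<lambda>j. T j * infnorm (x - y) powr \<beta>)" by (rule summable_mult2[OF T(1)])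
    have sd: "summable (\<lambda>j. \<bar>u j x - u j y\<bar>)"
      by (rule summable_comparison_test'[OF sT, of 0]) (simp add: T(2)[OF x y])
    have "?g x - ?g y = (\<Sum>j. u j x - u j y)" using suminf_diff[OF sum[OF x] sum[OF y]] .
    also have "\<bar>\<dots>\<bar> \<le> (\<Sum>j. \<bar>u j x - u j y\<bar>)" by (rule summable_rabs[OF sd])
    also have "\<dots> \<le> (\<Sum>j. T j * infnorm (x - y) powr \<beta>)" by (rule suminf_le[OF T(2)[OF x y] sd sT])
    also have "\<dots> = suminf T * infnorm (x - y) powr \<beta>" by (rule suminf_mult2[OF T(1), symmetric])
    also have "\<dots> \<le> (suminf S + suminf T) * infnorm (x - y) powr \<beta>"
      using suminf_nonneg[OF S(1) S0] by (intro mult_right_mono) auto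
    finally show "\<bar>?g x - ?g y\<bar> \<le> (suminf S + suminf T) * infnorm (x - y) powr \<beta>" .
  qed
  have g[measurable]: "?g \<in> borel_measurable cube_measure"
    by (intro continuous_on_cube_measurable hoelder_bounded_continuous_on[OF hb \<beta>])
  have "AE x in cube_measure. f x - ?g x = 0"
  proof (rule Lp_limit_AE_zero[OF p])
    fix e :: real assume e: "e > 0"
    have "\<forall>\<^sub>F j in sequentially. K j < e" using order_tendstoD(2)[OF K(2) e] .
    moreover have "(\<lambda>j. \<Sum>i<Suc j. S i) \<longlonglongrightarrow> suminf S"
      using summable_LIMSEQ[OF S(1)] by (rule LIMSEQ_Suc)
    then have "\<forall>\<^sub>F j in sequentially. suminf S - e < (\<Sum>i<Suc j. S i)"
      using e by (intro order_tendstoD(1)) auto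
    ultimately have "\<forall>\<^sub>F j in sequentially. K j < e \<and> suminf S - e < (\<Sum>i<Suc j. S i)"
      by eventually_elim auto
    then obtain j where j: "K j < e" "suminf S - e < (\<Sum>i<Suc j. S i)"
      by (auto dest!: eventually_happens'[OF sequentially_bot])
    have "\<bar>(f x - ?g x) - (f x - (\<Sum>i\<le>j. u i x))\<bar> \<le> e" if x: "x \<in> unit_cube" for x
    proof -
      have "(f x - ?g x) - (f x - (\<Sum>i\<le>j. u i x)) = - (\<Sum>i. u (i + Suc j) x)"
        using suminf_minus_initial_segment[OF sum[OF x], of "Suc j"] by (simp add: lessThan_Suc_atMost)
      also have "\<bar>\<dots>\<bar> \<le> (\<Sum>i. \<bar>u (i + Suc j) x\<bar>)"
        using summable_rabs[OF summable_ignore_initial_segment[OF sum_abs[OF x], of "Suc j"]] by simp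
      also have "\<dots> \<le> (\<Sum>i. S (i + Suc j))"
        by (rule suminf_le[OF S(2)[OF x] summable_ignore_initial_segment[OF sum_abs[OF x]]
              summable_ignore_initial_segment[OF S(1)]])
      also have "\<dots> = suminf S - (\<Sum>i<Suc j. S i)" by (rule suminf_minus_initial_segment[OF S(1)])
      finally show ?thesis using j by simp
    qed
    moreover have "Lp_norm p (\<lambda>x. f x - (\<Sum>i\<le>j. u i x)) \<le> ennreal e"
      using K(1)[of j] j(1) by (meson ennreal_leI less_imp_le order_trans)
    ultimately show "\<exists>h'\<in>borel_measurable cube_measure. Lp_norm p h' \<le> ennreal e \<and>
       (\<forall>x\<in>unit_cube. \<bar>(f x - ?g x) - h' x\<bar> \<le> e)"
      by (intro bexI[of _ "\<lambda>x. f x - (\<Sum>i\<le>j. u i x)"] conjI ballI borel_measurable_diff f G) auto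
  qed (intro borel_measurable_diff f g)
  then show "AE x in cube_measure. f x = (\<Sum>j. u j x)" by simp
qed

text \<open>The infimum over the class need not be attained; the factor 2 leaves room for a
  near-best approximant.\<close>

lemma approx_Gamma_leD:
  fixes f :: "real^'d::finite \<Rightarrow> real"
  assumes "approx_Gamma \<l> c \<alpha> p f \<le> 1"
  shows "Lp_norm p f \<le> 1"
    and "n \<ge> 1 \<Longrightarrow> \<exists>g\<in>nn_class \<l> c n. Lp_norm p (\<lambda>x. f x - g x) \<le> ennreal (2 * real n powr - \<alpha>)"
proof -
  show "Lp_norm p f \<le> 1" using assms by (simp add: approx_Gamma_def)
  assume n: "n \<ge> 1"
  define D where "D = Lp_dist p f (nn_class \<l> c n)"
  have "ennreal (real n powr \<alpha>) * D \<le> (SUP n\<in>{1..}. ennreal (real n powr \<alpha>) * Lp_dist p f (nn_class \<l> c n))"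
    unfolding D_def using n by (intro SUP_upper2[of n]) auto
  also have "\<dots> \<le> 1" using assms by (simp add: approx_Gamma_def)
  finally have D1: "ennreal (real n powr \<alpha>) * D \<le> 1" .
  have "D = ennreal (real n powr - \<alpha>) * (ennreal (real n powr \<alpha>) * D)"
    using n by (simp add: mult.assoc[symmetric] ennreal_mult[symmetric] powr_add[symmetric])
  also have "\<dots> \<le> ennreal (real n powr - \<alpha>) * 1" by (intro mult_left_mono D1) simp
  also have "\<dots> < ennreal (2 * real n powr - \<alpha>)" using n by (simp add: ennreal_lessI)
  finally have "\<exists>g\<in>nn_class \<l> c n. Lp_norm p (\<lambda>x. f x - g x) < ennreal (2 * real n powr - \<alpha>)"
    unfolding D_def Lp_dist_def INF_less_iff .
  then show "\<exists>g\<in>nn_class \<l> c n. Lp_norm p (\<lambda>x. f x - g x) \<le> ennreal (2 * real n powr - \<alpha>)"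
    by (meson less_imp_le)
qed

text \<open>Write \<bar>t\<bar> as the product of its powers 1 - \<beta> and \<beta>, and use one
  bound for each factor.\<close>

lemma hoelder_interpolation:
  fixes t :: real
  assumes "\<bar>t\<bar> \<le> a" "\<bar>t\<bar> \<le> M * \<rho>" "0 \<le> M" "0 \<le> \<rho>" "0 < \<beta>" "\<beta> < 1"
  shows "\<bar>t\<bar> \<le> a powr (1 - \<beta>) * M powr \<beta> * \<rho> powr \<beta>"
proof (cases "t = 0")
  case False
  have "\<bar>t\<bar> = \<bar>t\<bar> powr (1 - \<beta>) * \<bar>t\<bar> powr \<beta>" using False by (simp add: powr_add[symmetric])
  also have "\<dots> \<le> a powr (1 - \<beta>) * (M * \<rho>) powr \<beta>"
    using assms by (intro mult_mono powr_mono2) auto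
  finally show ?thesis using assms by (simp add: powr_mult mult_ac)
qed simp

lemma approx_unit_ball_hoelder:
  fixes p :: ereal and \<alpha> \<beta> \<theta> \<kappa> K2 :: real
  defines "\<delta> \<equiv> real CARD('d) * real_of_ereal (1 / p)"
  assumes p: "0 < p" and \<alpha>: "0 < \<alpha>"
    and l: "\<And>n. n \<ge> 1 \<Longrightarrow> \<l> n \<le> enat L" and c: "\<And>n. n \<ge> 1 \<Longrightarrow> c n \<ge> 1"
    and K2: "\<And>n. n \<ge> 1 \<Longrightarrow> ereal_of_enat (c n) \<le> ereal (K2 * real n powr \<theta> * ln (2 * real n) powr \<kappa>)"
    and \<theta>: "\<theta> \<ge> 0" and \<beta>: "0 < \<beta>" "\<beta> < 1"
    and gt: "\<alpha> * (1 - \<beta>) > (\<beta> + \<delta>) * (\<theta> * real L + real (L div 2))"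
  obtains C where "C > 0"
    "\<And>f :: real^'d::finite \<Rightarrow> real. f \<in> borel_measurable cube_measure \<Longrightarrow> approx_Gamma \<l> c \<alpha> p f \<le> 1 \<Longrightarrow>
      \<exists>g. hoelder_bounded \<beta> C g \<and> (AE x in cube_measure. f x = g x)"
proof -
  have \<delta>: "0 \<le> \<delta>" using p by (cases p) (auto simp: \<delta>_def one_ereal_def)
  \<comment> \<open>The slack of the hypothesis, expressed in the exponent of the slope. Division by
    L + 1 makes the loss L \<epsilon> strictly smaller than it.\<close>
  define gap where "gap = \<alpha> * (1 - \<beta>) / (\<beta> + \<delta>) - (\<theta> * real L + real (L div 2))"
  have gap: "gap > 0" using gt \<beta> \<delta> by (simp add: gap_def field_simps)
  define \<epsilon> where "\<epsilon> = gap / (real L + 1)"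
  have \<epsilon>: "\<epsilon> > 0" using gap by (simp add: \<epsilon>_def)
  define \<gamma> where "\<gamma> = real L * (\<theta> + \<epsilon>) + real (L div 2)"
  have \<gamma>0: "\<gamma> \<ge> 0" using \<theta> \<epsilon> by (simp add: \<gamma>_def)
  have "real L * \<epsilon> < gap" using gap by (simp add: \<epsilon>_def field_simps)
  then have "\<gamma> < \<alpha> * (1 - \<beta>) / (\<beta> + \<delta>)" by (simp add: \<gamma>_def gap_def algebra_simps)
  then have \<gamma>: "\<gamma> * (\<beta> + \<delta>) < \<alpha> * (1 - \<beta>)" using \<beta> \<delta> by (simp add: field_simps)
  \<comment> \<open>This makes the sup norms decay. It is the case \<beta> = 0 of the condition for
    the Hoelder norms and follows from that condition.\<close>
  have \<alpha>\<gamma>: "\<gamma> * \<delta> < \<alpha>"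
  proof -
    have "\<gamma> * \<delta> * (1 - \<beta>) \<le> \<gamma> * \<delta>" using \<gamma>0 \<delta> \<beta> by (simp add: mult_left_le)
    also have "\<dots> \<le> \<gamma> * (\<beta> + \<delta>)" using \<gamma>0 \<beta> by (intro mult_left_mono) auto
    also note \<gamma>
    finally show ?thesis using \<beta> by simp
  qed
  obtain A where A: "A \<ge> 2 powr \<alpha>" and lip: "\<And>n (g :: real^'d::finite \<Rightarrow> real) x y. n \<ge> 1 \<Longrightarrow> g \<in> nn_class \<l> c n \<Longrightarrow>
      \<bar>g x - g y\<bar> \<le> A * real n powr \<gamma> * infnorm (x - y)"
  proof (rule nn_class_lipschitz_growth[where ?'d = 'd and ?A0.0 = "2 powr \<alpha>", OF l c K2 \<epsilon>, folded \<gamma>_def])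
    fix A assume "2 powr \<alpha> \<le> A" "\<And>n (g :: real^'d \<Rightarrow> real) x y. n \<ge> 1 \<Longrightarrow> g \<in> nn_class \<l> c n \<Longrightarrow>
      \<bar>g x - g y\<bar> \<le> A * real n powr \<gamma> * infnorm (x - y)"
    from that[OF this] show thesis .
  qed auto
  have "0 < 2 powr \<alpha>" by simp
  with A have A0: "A > 0" by linarith
  \<comment> \<open>K j is the error bound 2 n^(-\<alpha>) at n = 2^(j-1), the coarser of the two
    approximants in the j-th difference. M j adds their two Lipschitz constants, both bounded by the
    finer one; A \<ge> 2 powr \<alpha> ensures K j \<le> M j.\<close>
  define K where "K j = 2 * 2 powr \<alpha> * 2 powr (- \<alpha> * real j)" for j :: nat
  define M where "M j = 2 * A * 2 powr (\<gamma> * real j)" for j :: nat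
  define q where "q = real_of_ereal (1 / p)"
  define S where "S j = 4 * 2 powr q * (K j * M j powr \<delta>) powr (1 / (1 + \<delta>))" for j
  define T where "T j = (2 * S j) powr (1 - \<beta>) * M j powr \<beta>" for j
  define e1 where "e1 = (\<alpha> - \<gamma> * \<delta>) / (1 + \<delta>)"
  define e2 where "e2 = e1 * (1 - \<beta>) - \<gamma> * \<beta>"
  have e1: "e1 > 0" using \<alpha>\<gamma> \<delta> by (simp add: e1_def)
  have e1\<delta>: "e1 * (1 + \<delta>) = \<alpha> - \<gamma> * \<delta>" using \<delta> by (simp add: e1_def)
  \<comment> \<open>e1 and e2 are the decay rates of S and T. Clearing the denominator shows that e2
    > 0 is the strict inequality assumed for \<gamma>.\<close>
  have "e2 * (1 + \<delta>) = e1 * (1 + \<delta>) * (1 - \<beta>) - \<gamma> * \<beta> * (1 + \<delta>)"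
    by (simp add: e2_def algebra_simps)
  also have "\<dots> = \<alpha> * (1 - \<beta>) - \<gamma> * (\<beta> + \<delta>)"
    unfolding e1\<delta> by (simp add: algebra_simps)
  finally have "e2 * (1 + \<delta>) > 0" using \<gamma> by simp
  then have e2: "e2 > 0" using \<delta> by (simp add: zero_less_mult_iff)
  define S0 where "S0 = 4 * 2 powr q * (2 * 2 powr \<alpha> * (2 * A) powr \<delta>) powr (1 / (1 + \<delta>))"
  have S: "S j = S0 * 2 powr (- e1 * real j)" for j
  proof -
    have "K j * M j powr \<delta> = (2 * 2 powr \<alpha> * (2 * A) powr \<delta>) * 2 powr ((\<gamma> * \<delta> - \<alpha>) * real j)"
    proof -
      have "2 powr (- \<alpha> * real j) * 2 powr (\<gamma> * real j * \<delta>) = 2 powr ((\<gamma> * \<delta> - \<alpha>) * real j)"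
        unfolding powr_add[symmetric] by (rule arg_cong[of _ _ "(powr) 2"]) (simp add: algebra_simps)
      then show ?thesis using A0 by (simp add: K_def M_def powr_mult powr_powr mult_ac)
    qed
    moreover have "(\<gamma> * \<delta> - \<alpha>) * real j * (1 / (1 + \<delta>)) = - e1 * real j"
    proof -
      have "\<gamma> * \<delta> - \<alpha> = - (e1 * (1 + \<delta>))" using e1\<delta> by simp
      then show ?thesis using \<delta> by simp
    qed
    ultimately show ?thesis using A0 by (simp add: S_def S0_def powr_mult powr_powr)
  qed
  have S0: "S0 > 0" using A0 by (simp add: S0_def)
  define T0 where "T0 = (2 * S0) powr (1 - \<beta>) * (2 * A) powr \<beta>"
  have T: "T j = T0 * 2 powr (- e2 * real j)" for j
  proof -
    have "T j = T0 * (2 powr (- e1 * real j * (1 - \<beta>)) * 2 powr (\<gamma> * real j * \<beta>))"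
      using S0 A0 by (simp add: T_def T0_def S M_def powr_mult powr_powr)
    also have "2 powr (- e1 * real j * (1 - \<beta>)) * 2 powr (\<gamma> * real j * \<beta>) = 2 powr (- e2 * real j)"
      unfolding powr_add[symmetric] by (rule arg_cong[of _ _ "(powr) 2"]) (simp add: e2_def algebra_simps)
    finally show ?thesis .
  qed
  have geom: "summable (\<lambda>j::nat. a * 2 powr (- e * real j))" if "e > 0" for a e :: real
  proof (rule summable_mult)
    have "2 powr (- e * real j) = (2 powr - e) ^ j" for j
      by (simp add: powr_realpow[symmetric] powr_powr)
    then show "summable (\<lambda>j::nat. 2 powr (- e * real j))"
      using that powr_less_mono[of "- e" 0 2] by (simp add: summable_geometric_iff)
  qed
  have sumS: "summable S" unfolding S using geom[OF e1] .
  have sumT: "summable T" unfolding T using geom[OF e2] .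
  have pow2: "real ((2::nat) ^ j) powr a = 2 powr (a * real j)" for j a
    by (simp add: powr_realpow[symmetric] powr_powr mult.commute)
  have K_anti: "K (Suc j) \<le> K j" for j
  proof -
    have "2 powr (- \<alpha> * real (Suc j)) \<le> 2 powr (- \<alpha> * real j)"
      using \<alpha> by (intro powr_mono) (auto simp: algebra_simps)
    then show ?thesis unfolding K_def by (rule mult_left_mono) simp
  qed
  have KM: "0 < K j" "K j \<le> M j" for j
  proof -
    show "0 < K j" by (simp add: K_def)
    have "2 powr (- \<alpha> * real j) \<le> 2 powr 0" using \<alpha> by (intro powr_mono) auto
    moreover have "2 powr 0 \<le> 2 powr (\<gamma> * real j)" using \<gamma>0 by (intro powr_mono) auto
    ultimately have "2 powr (- \<alpha> * real j) \<le> 2 powr (\<gamma> * real j)" by (rule order_trans)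
    with A have "2 powr \<alpha> * 2 powr (- \<alpha> * real j) \<le> A * 2 powr (\<gamma> * real j)"
      using A0 by (intro mult_mono) auto
    then show "K j \<le> M j" by (simp add: K_def M_def)
  qed
  define C where "C = suminf S + suminf T"
  have "suminf S > 0" using sumS S0 by (intro suminf_pos) (auto simp: S)
  moreover have "suminf T \<ge> 0" using sumT by (intro suminf_nonneg) (auto simp: T_def)
  ultimately have C: "C > 0" by (simp add: C_def)
  show thesis
  proof (rule that[OF C])
    fix f :: "real^'d \<Rightarrow> real"
    assume f[measurable]: "f \<in> borel_measurable cube_measure" and \<Gamma>: "approx_Gamma \<l> c \<alpha> p f \<le> 1"
    have "\<forall>j. \<exists>g\<in>nn_class \<l> c (2 ^ j). Lp_norm p (\<lambda>x. f x - g x) \<le> ennreal (2 * real (2 ^ j) powr - \<alpha>)"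
      by (intro allI approx_Gamma_leD(2)[OF \<Gamma>]) simp
    then obtain G where G: "\<And>j. G j \<in> nn_class \<l> c (2 ^ j)"
      "\<And>j. Lp_norm p (\<lambda>x. f x - G j x) \<le> ennreal (2 * real (2 ^ j) powr - \<alpha>)" by metis
    have Glip: "\<bar>G j x - G j y\<bar> \<le> A * 2 powr (\<gamma> * real j) * infnorm (x - y)" for j x y
      using lip[OF _ G(1), of j x y] unfolding pow2 by simp
    have GK: "Lp_norm p (\<lambda>x. f x - G j x) \<le> ennreal (K (Suc j))" for j
    proof -
      have "2 * real (2 ^ j) powr - \<alpha> = K (Suc j)"
        unfolding pow2 by (simp add: K_def powr_add[symmetric] algebra_simps)
      then show ?thesis using G(2)[of j] by simp
    qed
    have Gm[measurable]: "G j \<in> borel_measurable cube_measure" for j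
      by (rule continuous_on_cube_measurable[OF lipschitz_continuous_on[OF Glip]])
    define u where "u j x = (case j of 0 \<Rightarrow> G 0 x | Suc i \<Rightarrow> G (Suc i) x - G i x)" for j x
    have sum_u: "(\<Sum>i\<le>j. u i x) = G j x" for j x by (induction j) (auto simp: u_def)
    have ulip: "\<bar>u j x - u j y\<bar> \<le> M j * infnorm (x - y)" for j x y
    proof (cases j)
      case 0
      have "A * infnorm (x - y) \<le> M 0 * infnorm (x - y)"
        using A0 by (intro mult_right_mono) (auto simp: M_def infnorm_pos_le)
      then show ?thesis using 0 Glip[of 0 x y] by (simp add: u_def)
    next
      case (Suc i)
      have "\<bar>u j x - u j y\<bar> \<le> \<bar>G (Suc i) x - G (Suc i) y\<bar> + \<bar>G i x - G i y\<bar>"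
        using Suc by (simp add: u_def)
      also have "\<dots> \<le> A * 2 powr (\<gamma> * real j) * infnorm (x - y) + A * 2 powr (\<gamma> * real i) * infnorm (x - y)"
        using Glip[of "Suc i" x y] Glip[of i x y] Suc by simp
      also have "\<dots> \<le> A * 2 powr (\<gamma> * real j) * infnorm (x - y) + A * 2 powr (\<gamma> * real j) * infnorm (x - y)"
        using A0 \<gamma>0 Suc
        by (intro add_left_mono mult_right_mono mult_left_mono powr_mono) (auto simp: infnorm_pos_le)
      finally show ?thesis by (simp add: M_def mult_ac)
    qed
    have uS: "\<bar>u j x\<bar> \<le> S j" if x: "x \<in> unit_cube" for j x
    proof (cases j)
      case 0
      \<comment> \<open>The first term is G 0 = f - (f - G 0), so the norm of f itself enters here
        and must lie below K 0.\<close>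
      have "1 \<le> K 0" using \<alpha> ge_one_powr_ge_zero[of 2 \<alpha>] by (simp add: K_def)
      then have 1: "Lp_norm p f \<le> ennreal (K 0)"
        using approx_Gamma_leD(1)[OF \<Gamma>] by (metis ennreal_1 ennreal_leI order_trans)
      have 2: "Lp_norm p (\<lambda>x. f x - G 0 x) \<le> ennreal (K 0)"
        using GK[of 0] K_anti[of 0] by (meson ennreal_leI order_trans)
      have "\<bar>u 0 x\<bar> \<le> S 0"
        unfolding S_def \<delta>_def q_def
        by (rule lipschitz_sup_bound[OF p f _ 1 2 KM _ ulip x]) (auto simp: u_def)
      then show ?thesis using 0 by simp
    next
      case (Suc i)
      \<comment> \<open>The difference is (f - G i) - (f - G (Suc i)); only these two errors are
        measured in L^p.\<close>
      have 2: "Lp_norm p (\<lambda>x. f x - G (Suc i) x) \<le> ennreal (K (Suc i))"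
        using GK[of "Suc i"] K_anti[of "Suc i"] by (meson ennreal_leI order_trans)
      have "\<bar>u (Suc i) x\<bar> \<le> S (Suc i)"
        unfolding S_def \<delta>_def q_def
        by (rule lipschitz_sup_bound[OF p _ _ GK 2 KM _ ulip x]) (auto simp: u_def)
      then show ?thesis using Suc by simp
    qed
    have uT: "\<bar>u j x - u j y\<bar> \<le> T j * infnorm (x - y) powr \<beta>"
      if "x \<in> unit_cube" "y \<in> unit_cube" for j x y
      unfolding T_def
    proof (rule hoelder_interpolation[OF _ ulip _ _ \<beta>])
      show "\<bar>u j x - u j y\<bar> \<le> 2 * S j" using uS[OF that(1), of j] uS[OF that(2), of j] by linarith
      show "0 \<le> M j" using KM[of j] by simp
    qed (rule infnorm_pos_le)
    have K0: "(\<lambda>j. K (Suc j)) \<longlonglongrightarrow> 0"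
      unfolding K_def using \<alpha> by real_asymp
    show "\<exists>g. hoelder_bounded \<beta> C g \<and> (AE x in cube_measure. f x = g x)"
      unfolding C_def
      using telescoping_hoelder[where u = u and K = "\<lambda>j. K (Suc j)", OF p \<beta>(1) f _ sumS uS sumT uT _ K0]
      by (auto simp: sum_u GK)
  qed
qed

text \<open>The infimum defining \<open>approx_norm\<close> need not be attained. Each admissible
  scale t yields its own representative bounded by C t; continuity makes them equal on the cube, so
  one representative satisfies all the bounds.\<close>

lemma embeds_if_unit_ball:
  assumes \<beta>: "\<beta> > 0" and C: "C > 0"
    and ball: "\<And>f :: real^'d::finite \<Rightarrow> real. f \<in> borel_measurable cube_measure \<Longrightarrow> approx_Gamma \<l> c \<alpha> p f \<le> 1 \<Longrightarrow>
      \<exists>g. hoelder_bounded \<beta> C g \<and> (AE x in cube_measure. f x = g x)"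
  shows "embeds (approx_space \<l> c \<alpha> p :: (real^'d \<Rightarrow> real) set) (approx_norm \<l> c \<alpha> p)
           (hoelder_space \<beta>) (hoelder_norm \<beta>)"
  unfolding embeds_def
proof (intro exI[of _ "2 * C"] conjI ballI)
  fix f :: "real^'d \<Rightarrow> real" assume f: "f \<in> approx_space \<l> c \<alpha> p"
  define T where "T = {t. t > 0 \<and> approx_Gamma \<l> c \<alpha> p (\<lambda>x. f x / t) \<le> 1}"
  have fm[measurable]: "f \<in> borel_measurable cube_measure"
    using f by (simp add: approx_space_def Lp_space_def)
  have norm: "approx_norm \<l> c \<alpha> p f = (INF t\<in>T. ennreal t)" by (simp add: approx_norm_def T_def)
  \<comment> \<open>An infimum over the empty set would be infinite.\<close>
  then have "T \<noteq> {}" using f by (auto simp: approx_space_def top_ennreal_def)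
  then obtain t0 where t0: "t0 \<in> T" by auto
  have scaled: "\<exists>g. hoelder_bounded \<beta> (C * t) g \<and> (AE x in cube_measure. f x = g x)" if "t \<in> T" for t
  proof -
    have t: "t > 0" "approx_Gamma \<l> c \<alpha> p (\<lambda>x. f x / t) \<le> 1" using that by (auto simp: T_def)
    obtain g where g: "hoelder_bounded \<beta> C g" "AE x in cube_measure. f x / t = g x"
      using ball[OF _ t(2)] by auto
    have "hoelder_bounded \<beta> (C * t) (\<lambda>x. t * g x)"
      using g(1) t(1) unfolding hoelder_bounded_def
      by (auto simp: abs_mult right_diff_distrib[symmetric] mult_ac)
    moreover have "AE x in cube_measure. f x = t * g x"
      using g(2) by eventually_elim (use t in \<open>auto simp: field_simps\<close>)
    ultimately show ?thesis by blast
  qed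
  obtain g where g: "hoelder_bounded \<beta> (C * t0) g" "AE x in cube_measure. f x = g x" using scaled[OF t0] by auto
  have "hoelder_norm \<beta> g \<le> ennreal (2 * C) * ennreal t" if t: "t \<in> T" for t
  proof -
    obtain k where k: "hoelder_bounded \<beta> (C * t) k" "AE x in cube_measure. f x = k x" using scaled[OF t] by auto
    have eq: "g x = k x" if "x \<in> unit_cube" for x
    proof -
      have "g x - k x = 0"
      proof (rule continuous_AE_zero[OF _ _ that])
        show "continuous_on unit_cube (\<lambda>x. g x - k x)"
          by (intro continuous_intros hoelder_bounded_continuous_on[OF g(1) \<beta>] hoelder_bounded_continuous_on[OF k(1) \<beta>])
        show "AE x in cube_measure. g x - k x = 0" using g(2) k(2) by eventually_elim simp
      qed
      then show ?thesis by simp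
    qed
    then have "hoelder_bounded \<beta> (C * t) g" using k(1) unfolding hoelder_bounded_def by auto
    then have "hoelder_norm \<beta> g \<le> ennreal (2 * (C * t))" by (rule hoelder_norm_le) (rule \<beta>)
    then show ?thesis using C t by (simp add: ennreal_mult[symmetric] T_def mult_ac)
  qed
  \<comment> \<open>The constant is divided out so that the bounds for all t in T combine into one
    for the infimum, and is multiplied back afterwards.\<close>
  then have "hoelder_norm \<beta> g / ennreal (2 * C) \<le> (INF t\<in>T. ennreal t)"
    using C by (intro INF_greatest divide_le_posI_ennreal) (auto simp: mult.commute)
  then have "ennreal (2 * C) * (hoelder_norm \<beta> g / ennreal (2 * C)) \<le> ennreal (2 * C) * (INF t\<in>T. ennreal t)"
    by (rule mult_left_mono) simp
  moreover have "ennreal (2 * C) * (hoelder_norm \<beta> g / ennreal (2 * C)) = hoelder_norm \<beta> g"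
    using C by (simp add: ennreal_times_divide mult.commute[of "ennreal _"] mult_divide_eq_ennreal)
  ultimately have "hoelder_norm \<beta> g \<le> ennreal (2 * C) * (INF t\<in>T. ennreal t)" by simp
  then have le: "hoelder_norm \<beta> g \<le> ennreal (2 * C) * approx_norm \<l> c \<alpha> p f" by (simp add: norm)
  moreover have "\<dots> < \<infinity>" using f by (auto simp: approx_space_def ennreal_mult_less_top)
  ultimately have "g \<in> hoelder_space \<beta>" by (auto simp: hoelder_space_def)
  then show "\<exists>g\<in>hoelder_space \<beta>. (AE x in cube_measure. f x = g x) \<and>
      hoelder_norm \<beta> g \<le> ennreal (2 * C) * approx_norm \<l> c \<alpha> p f"
    using g(2) le by blast
qed (use C in simp)

section \<open>Necessity\<close>

text \<open>The support has volume at most r^d, whose power 1/p is r^(d/p). For p = \<infinity> the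
  exponent is 0 and the sup bound h remains.\<close>

lemma Lp_norm_bump:
  fixes f :: "real^'d::finite \<Rightarrow> real"
  assumes p: "0 < p" and f[measurable]: "f \<in> borel_measurable cube_measure"
    and h: "0 \<le> h" "\<And>x. x \<in> unit_cube \<Longrightarrow> \<bar>f x\<bar> \<le> h"
    and r: "0 < r" "r \<le> 1" "\<And>x. x \<in> unit_cube \<Longrightarrow> x \<notin> cbox 0 (r *\<^sub>R 1) \<Longrightarrow> f x = 0"
  shows "Lp_norm p f \<le> ennreal (h * r powr (real CARD('d) * real_of_ereal (1 / p)))"
proof (cases "p = \<infinity>")
  case True
  have "esssup cube_measure (\<lambda>x. ennreal \<bar>f x\<bar>) \<le> ennreal h"
    using h by (intro esssup_I AE_I2 ennreal_leI) auto
  then show ?thesis using True r by (simp add: Lp_norm_def)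
next
  case False
  then obtain s where s: "p = ereal s" "0 < s" using p by (cases p) auto
  define B :: "(real^'d) set" where "B = cbox 0 (r *\<^sub>R 1)"
  have sub: "B \<subseteq> unit_cube"
    using order_trans[OF _ r(2)] by (fastforce simp: B_def mem_box_cart)
  have Bs[measurable]: "B \<in> sets cube_measure"
    by (rule cube_measure_subset(1)[OF _ sub]) (simp add: B_def)
  have "0 \<in> B" using r by (simp add: B_def mem_box_cart)
  then have ne: "B \<noteq> {}" by blast
  have "emeasure cube_measure B = emeasure lebesgue B"
    using sub by (intro emeasure_restrict_space) (auto simp: B_def)
  also have "\<dots> = ennreal (measure lborel B)"
    by (simp add: B_def emeasure_eq_measure2 emeasure_lborel_cbox_eq)
  also have "measure lborel B = r ^ CARD('d)"
    using content_cbox_cart[OF ne[unfolded B_def]] by (simp add: B_def)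
  finally have eB: "emeasure cube_measure B = ennreal (r ^ CARD('d))" .
  have "(\<integral>\<^sup>+ x. ennreal (\<bar>f x\<bar> powr s) \<partial>cube_measure) \<le> (\<integral>\<^sup>+ x. ennreal (h powr s) * indicator B x \<partial>cube_measure)"
    using h r s by (intro nn_integral_mono) (auto simp: B_def split: split_indicator intro!: powr_mono2 ennreal_leI)
  also have "\<dots> = ennreal (h powr s) * ennreal (r ^ CARD('d))"
    by (simp add: nn_integral_cmult_indicator eB)
  also have "\<dots> = ennreal (h powr s * r ^ CARD('d))" using r by (simp add: ennreal_mult)
  finally have I: "(\<integral>\<^sup>+ x. ennreal (\<bar>f x\<bar> powr s) \<partial>cube_measure) \<le> ennreal (h powr s * r ^ CARD('d))" .
  define I where "I = (\<integral>\<^sup>+ x. ennreal (\<bar>f x\<bar> powr s) \<partial>cube_measure)"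
  have "I \<noteq> \<infinity>" using I by (auto simp: I_def top_unique)
  moreover have "enn2real I \<le> h powr s * r ^ CARD('d)"
    using I r unfolding I_def[symmetric] by (intro enn2real_leI) auto
  then have "enn2real I powr (1 / s) \<le> (h powr s * r ^ CARD('d)) powr (1 / s)"
    using s by (intro powr_mono2) auto
  moreover have "(h powr s * r ^ CARD('d)) powr (1 / s) = h * r powr (real CARD('d) * (1 / s))"
    using h(1) r s by (simp add: powr_mult powr_powr powr_realpow[symmetric])
  ultimately have "ennreal_powr I (1 / s) \<le> ennreal (h * r powr (real CARD('d) * (1 / s)))"
    by (simp add: ennreal_powr_def ennreal_leI)
  then show ?thesis using s by (simp add: Lp_norm_def I_def one_ereal_def)
qed

text \<open>From n weights on, f is represented exactly. With m < n weights the zero function is a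
  competitor with error at most n^(-\<alpha>) \<le> m^(-\<alpha>).\<close>

lemma approx_Gamma_le_one:
  fixes f :: "real^'d::finite \<Rightarrow> real"
  assumes p: "0 < p" and \<alpha>: "0 < \<alpha>" and n: "n \<ge> 1" and f: "f \<in> nn_class \<l> c n"
    and l: "\<And>m. m \<ge> 1 \<Longrightarrow> \<l> m \<ge> 2" "mono_on {1..} \<l>" and c: "mono_on {1..} c"
    and norm: "Lp_norm p f \<le> ennreal (real n powr - \<alpha>)"
  shows "approx_Gamma \<l> c \<alpha> p f \<le> 1"
  unfolding approx_Gamma_def
proof (intro max.boundedI SUP_least)
  have "real n powr - \<alpha> \<le> real n powr 0" using n \<alpha> by (intro powr_mono) auto
  then have "ennreal (real n powr - \<alpha>) \<le> 1" using n by (simp add: ennreal_le_1)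
  then show "Lp_norm p f \<le> 1" using norm by (rule order_trans[rotated])
  fix m :: nat assume "m \<in> {1..}"
  then have m: "m \<ge> 1" by simp
  show "ennreal (real m powr \<alpha>) * Lp_dist p f (nn_class \<l> c m) \<le> 1"
  proof (cases "n \<le> m")
    case True
    then have "f \<in> nn_class \<l> c m"
      using nn_class_mono[of n m \<l> c] f mono_onD[OF l(2), of n m] mono_onD[OF c, of n m] n by auto
    then have "Lp_dist p f (nn_class \<l> c m) \<le> Lp_norm p (\<lambda>x. f x - f x)"
      unfolding Lp_dist_def by (rule INF_lower)
    \<comment> \<open>The zero function is a bump of height 0.\<close>
    also have "\<dots> \<le> 0" using Lp_norm_bump[OF p, of "\<lambda>x::real^'d. 0" 0 1] by simp
    finally show ?thesis by simp
  next
    case False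
    have "\<l> m \<ge> 1" using l(1)[OF m] by (rule order_trans[rotated]) (simp add: one_enat_def numeral_eq_enat)
    then have "Lp_dist p f (nn_class \<l> c m) \<le> Lp_norm p (\<lambda>x. f x - 0)"
      unfolding Lp_dist_def by (intro INF_lower[OF zero_in_nn_class])
    also have "\<dots> \<le> ennreal (real n powr - \<alpha>)" using norm by simp
    finally have "ennreal (real m powr \<alpha>) * Lp_dist p f (nn_class \<l> c m) \<le> ennreal (real m powr \<alpha>) * ennreal (real n powr - \<alpha>)"
      by (rule mult_left_mono) simp
    also have "\<dots> = ennreal (real m powr \<alpha> * real n powr - \<alpha>)" by (simp add: ennreal_mult)
    also have "\<dots> \<le> ennreal (real n powr \<alpha> * real n powr - \<alpha>)"
      using False \<alpha> by (intro ennreal_leI mult_right_mono powr_mono2) auto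
    also have "\<dots> = 1" using n by (simp add: powr_add[symmetric])
    finally show ?thesis .
  qed
qed

text \<open>
  The test function \<open>x \<mapsto> h \<cdot> relu (1 - M (x\<^sub>1 + \<dots> + x\<^sub>d))\<close> has slope \<open>s = h M\<close>, the largest one attainable
  by the amplified ridge networks; \<open>h\<close> is chosen such that \<open>h M powr - \<delta> = n powr - \<alpha>\<close>, which makes
  its approximation norm at most 1.
\<close>
lemma embedding_slope_bound:
  fixes p :: ereal and \<alpha> \<beta> K :: real
  defines "\<delta> \<equiv> real CARD('d) * real_of_ereal (1 / p)"
  assumes p: "0 < p" and \<alpha>: "0 < \<alpha>" and n: "n \<ge> 1"
    and l: "\<And>m. m \<ge> 1 \<Longrightarrow> \<l> m \<ge> 2" "mono_on {1..} \<l>" and c: "mono_on {1..} c"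
    and L: "L \<ge> 2" "enat L \<le> \<l> n" and C: "c n = enat C" "C \<ge> 1"
    and N: "N \<ge> 1" "(CARD('d) + 2) * N * L \<le> n" and \<beta>: "0 < \<beta>" and K: "K > 0"
    and emb: "\<And>f :: real^'d::finite \<Rightarrow> real. f \<in> approx_space \<l> c \<alpha> p \<Longrightarrow>
       \<exists>g\<in>hoelder_space \<beta>. (AE x in cube_measure. f x = g x) \<and> hoelder_norm \<beta> g \<le> ennreal K * approx_norm \<l> c \<alpha> p f"
  shows "real n powr (- \<alpha> * (1 - \<beta>)) * (real C ^ L * real N ^ (L div 2)) powr (\<beta> + \<delta>) \<le> K powr (1 + \<delta>)"
proof -
  have \<delta>: "0 \<le> \<delta>" using p by (cases p) (auto simp: \<delta>_def one_ereal_def)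
  define s where "s = real C ^ L * real N ^ (L div 2)"
  have s: "s \<ge> 1" unfolding s_def using C(2) N(1)
    by (intro mult_ge1_I one_le_power) auto
  \<comment> \<open>Inserting h = s / M into the condition on h leaves M powr (1 + \<delta>) = s * n
    powr \<alpha>. As s and n powr \<alpha> are at least 1, so is M, and the bump fits into the
    cube.\<close>
  define M where "M = (s * real n powr \<alpha>) powr (1 / (1 + \<delta>))"
  define h where "h = s / M"
  have "1 \<le> s * real n powr \<alpha>"
    using s n \<alpha> by (intro mult_ge1_I ge_one_powr_ge_zero) auto
  then have M: "M \<ge> 1" unfolding M_def using \<delta> by (intro ge_one_powr_ge_zero) auto
  have h0: "h > 0" using s M by (simp add: h_def)
  have MM: "M powr (1 + \<delta>) = s * real n powr \<alpha>"
    unfolding M_def using \<delta> s n by (simp add: powr_powr)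
  have hM: "h * (1 / M) powr \<delta> = real n powr - \<alpha>"
  proof -
    have "h * (1 / M) powr \<delta> = s / M powr (1 + \<delta>)"
      using M by (simp add: h_def powr_divide powr_add)
    also have "\<dots> = real n powr - \<alpha>" unfolding MM using s by (simp add: powr_minus field_simps)
    finally show ?thesis .
  qed
  define f :: "real^'d \<Rightarrow> real" where
    "f = (\<lambda>x. real C ^ (L - 1) * real N ^ (L div 2) * relu (real C / M - real C * (\<Sum>i\<in>UNIV. vec_nth x i)))"
  \<comment> \<open>The bias C / M obeys the weight bound because M \<ge> 1.\<close>
  have f_in: "f \<in> nn_class \<l> c n"
    unfolding f_def using M C(2) by (intro nn_class_ridge L C N) (auto simp: divide_le_eq)
  have sC: "s = real C * (real C ^ (L - 1) * real N ^ (L div 2))"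
    using L(1) unfolding s_def by (cases L) auto
  have f_eq: "f x = s * relu (1 / M - (\<Sum>i\<in>UNIV. vec_nth x i))" for x
  proof -
    have "real C / M - real C * (\<Sum>i\<in>UNIV. vec_nth x i) = real C * (1 / M - (\<Sum>i\<in>UNIV. vec_nth x i))"
      by (simp add: right_diff_distrib)
    moreover have "relu (real C * t) = real C * relu t" for t
      using C(2) by (auto simp: relu_def max_def zero_le_mult_iff mult_le_0_iff)
    ultimately have "relu (real C / M - real C * (\<Sum>i\<in>UNIV. vec_nth x i)) = real C * relu (1 / M - (\<Sum>i\<in>UNIV. vec_nth x i))"
      by metis
    then show ?thesis unfolding f_def sC by (simp only: mult_ac)
  qed
  have cont: "continuous_on unit_cube f"
    unfolding f_eq relu_def by (intro continuous_intros)
  then have [measurable]: "f \<in> borel_measurable cube_measure"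
    by (rule continuous_on_cube_measurable)
  have bound: "\<bar>f x\<bar> \<le> h" if "x \<in> unit_cube" for x
  proof -
    have "(\<Sum>i\<in>UNIV. vec_nth x i) \<ge> 0" using that by (intro sum_nonneg) (auto simp: mem_box_cart)
    then have "\<bar>relu (1 / M - (\<Sum>i\<in>UNIV. vec_nth x i))\<bar> \<le> 1 / M" using M by (auto simp: relu_def)
    then have "s * \<bar>relu (1 / M - (\<Sum>i\<in>UNIV. vec_nth x i))\<bar> \<le> s * (1 / M)" using s by (intro mult_left_mono) auto
    then show ?thesis using s unfolding f_eq by (simp add: abs_mult h_def)
  qed
  have supp: "f x = 0" if x: "x \<in> unit_cube" "x \<notin> cbox 0 ((1 / M) *\<^sub>R 1)" for x
  proof -
    have x0: "0 \<le> vec_nth x i" for i using x(1) by (auto simp: mem_box_cart)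
    then obtain i where i: "vec_nth x i > 1 / M" using x(2) by (auto simp: mem_box_cart not_le)
    have "vec_nth x i \<le> (\<Sum>i\<in>UNIV. vec_nth x i)" using x0 by (intro member_le_sum) auto
    then show ?thesis using i by (simp add: f_eq relu_def)
  qed
  have nf: "Lp_norm p f \<le> ennreal (real n powr - \<alpha>)"
    using Lp_norm_bump[OF p, of f h "1 / M"] h0 M bound supp hM by (simp add: \<delta>_def)
  have \<Gamma>: "approx_Gamma \<l> c \<alpha> p f \<le> 1" by (rule approx_Gamma_le_one[OF p \<alpha> n f_in l c nf])
  have an: "approx_norm \<l> c \<alpha> p f \<le> 1"
    unfolding approx_norm_def by (rule INF_lower2[of 1]) (use \<Gamma> in auto)
  have "Lp_norm p f < \<infinity>" using nf by (rule le_less_trans) simp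
  moreover have "approx_norm \<l> c \<alpha> p f < \<infinity>" using an by (rule le_less_trans) simp
  ultimately have "f \<in> approx_space \<l> c \<alpha> p" by (simp add: approx_space_def Lp_space_def)
  from emb[OF this] obtain g where g: "AE x in cube_measure. f x = g x"
    "hoelder_norm \<beta> g \<le> ennreal K * approx_norm \<l> c \<alpha> p f" by blast
  have "ennreal K * approx_norm \<l> c \<alpha> p f \<le> ennreal K * 1" using an by (rule mult_left_mono) simp
  with g(2) have gK: "hoelder_norm \<beta> g \<le> ennreal K" by simp
  note gH = hoelder_norm_leD[OF gK less_imp_le[OF K]]
  \<comment> \<open>A representative may differ from f on a null set; continuity of both turns this
    into equality on the cube, so values at single points can be compared.\<close>
  have gc: "continuous_on unit_cube g" by (rule hoelder_continuous_on[OF \<beta>]) (rule gH)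
  have fg: "f x = g x" if "x \<in> unit_cube" for x
    using continuous_AE_zero[of "\<lambda>x. f x - g x" x] g(1) cont gc that
    by (auto intro!: continuous_intros elim: eventually_mono)
  \<comment> \<open>The corner of the supporting cube opposite to 0: its coordinates sum to d / M
    \<ge> 1 / M, so f vanishes there, and its maximum distance from 0 is the full width 1 /
    M.\<close>
  define y :: "real^'d" where "y = (1 / M) *\<^sub>R 1"
  have cube: "0 \<in> (unit_cube :: (real^'d) set)" "y \<in> unit_cube" using M by (auto simp: y_def mem_box_cart)
  have "f 0 = h" using M s by (simp add: f_eq relu_def h_def)
  moreover have "f y = 0"
  proof -
    have "(\<Sum>i\<in>UNIV. vec_nth y i) = real CARD('d) / M" by (simp add: y_def)
    moreover have "real CARD('d) / M \<ge> 1 / M" using M by (simp add: divide_right_mono Suc_le_eq)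
    ultimately show ?thesis by (simp add: f_eq relu_def)
  qed
  moreover have "infnorm (0 - y) = 1 / M"
    using M by (simp add: y_def infnorm_neg infnorm_mul infnorm_cart)
  ultimately have "h \<le> K * (1 / M) powr \<beta>"
    using gH[OF cube] h0 fg[OF cube(1)] fg[OF cube(2)] by simp
  then have "h * M powr \<beta> \<le> K" using M by (simp add: powr_divide field_simps)
  \<comment> \<open>The power 1 + \<delta> allows M to be eliminated through its defining
    equation.\<close>
  then have "(h * M powr \<beta>) powr (1 + \<delta>) \<le> K powr (1 + \<delta>)"
    using h0 \<delta> by (intro powr_mono2) auto
  also have "(h * M powr \<beta>) powr (1 + \<delta>) = s powr (1 + \<delta>) * (M powr (1 + \<delta>)) powr (\<beta> - 1)"
  proof -
    have "h * M powr \<beta> = s * M powr (\<beta> - 1)" using M by (simp add: h_def powr_diff)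
    then show ?thesis using s by (simp add: powr_mult powr_powr mult.commute)
  qed
  also have "\<dots> = s powr (1 + \<delta>) * (s powr (\<beta> - 1) * real n powr (\<alpha> * (\<beta> - 1)))"
    unfolding MM using s by (simp add: powr_mult powr_powr)
  also have "\<dots> = real n powr (- \<alpha> * (1 - \<beta>)) * s powr (\<beta> + \<delta>)"
    by (simp add: mult.assoc[symmetric] powr_add[symmetric] algebra_simps)
  finally show ?thesis by (simp add: s_def)
qed

text \<open>Monotonicity keeps depth L available from n0 on. Taking the width N proportional to n,
  the slope bound would keep n^e times a power of the logarithm bounded, although the slack e is
  positive. L may be any depth that occurs, which also serves unbounded depth.\<close>

lemma not_embeds_small_alpha:
  fixes p :: ereal and \<alpha> \<beta> \<theta> \<kappa> K1 :: real
  defines "\<delta> \<equiv> real CARD('d) * real_of_ereal (1 / p)"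
  assumes p: "0 < p" and \<alpha>: "0 < \<alpha>"
    and l: "\<And>m. m \<ge> 1 \<Longrightarrow> \<l> m \<ge> 2" "mono_on {1..} \<l>"
    and c: "\<And>m. m \<ge> 1 \<Longrightarrow> c m \<ge> 1" "mono_on {1..} c" "\<And>m. m \<ge> 1 \<Longrightarrow> c m \<noteq> \<infinity>"
    and K1: "K1 > 0" "\<And>n. n \<ge> 1 \<Longrightarrow> ereal (K1 * real n powr \<theta> * ln (2 * real n) powr \<kappa>) \<le> ereal_of_enat (c n)"
    and L: "L \<ge> 2" "n0 \<ge> 1" "enat L \<le> \<l> n0"
    and \<beta>: "0 < \<beta>" "\<beta> < 1"
    and less: "\<alpha> * (1 - \<beta>) < (\<beta> + \<delta>) * (\<theta> * real L + real (L div 2))"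
  shows "\<not> embeds (approx_space \<l> c \<alpha> p :: (real^'d::finite \<Rightarrow> real) set) (approx_norm \<l> c \<alpha> p)
           (hoelder_space \<beta>) (hoelder_norm \<beta>)"
proof
  assume "embeds (approx_space \<l> c \<alpha> p :: (real^'d \<Rightarrow> real) set) (approx_norm \<l> c \<alpha> p)
           (hoelder_space \<beta>) (hoelder_norm \<beta>)"
  then obtain K where K: "K > 0" and emb: "\<And>f :: real^'d::finite \<Rightarrow> real. f \<in> approx_space \<l> c \<alpha> p \<Longrightarrow>
       \<exists>g\<in>hoelder_space \<beta>. (AE x in cube_measure. f x = g x) \<and> hoelder_norm \<beta> g \<le> ennreal K * approx_norm \<l> c \<alpha> p f"
    unfolding embeds_def by blast
  have \<delta>: "0 \<le> \<delta>" using p by (cases p) (auto simp: \<delta>_def one_ereal_def)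
  define \<omega> where "\<omega> = \<beta> + \<delta>"
  have \<omega>: "\<omega> > 0" using \<beta> \<delta> by (simp add: \<omega>_def)
  define k where "k = L div 2"
  \<comment> \<open>Width N costs at most D N weights, so N = n div D respects the budget n.\<close>
  define D where "D = (CARD('d) + 2) * L"
  have D: "D \<ge> 1" using L by (simp add: D_def)
  define e where "e = \<omega> * (\<theta> * real L + real k) - \<alpha> * (1 - \<beta>)"
  have e: "e > 0" using less by (simp add: e_def \<omega>_def k_def)
  \<comment> \<open>The factors free of n in the lower bounds for the weights C and for the width, N
    \<ge> n / (2 D).\<close>
  define A where "A = (K1 ^ L * (1 / (2 * real D)) ^ k) powr \<omega>"
  have A: "A > 0" using K1(1) D by (simp add: A_def)
  define \<kappa>' where "\<kappa>' = \<kappa> * real L * \<omega>"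
  have bound: "A * (real n powr e * ln (2 * real n) powr \<kappa>') \<le> K powr (1 + \<delta>)"
    if n: "n \<ge> n0" "n \<ge> D" for n
  proof -
    have n1: "n \<ge> 1" using n(1) L(2) by simp
    obtain C where C: "c n = enat C" using c(3)[OF n1] by (cases "c n") auto
    have C1: "C \<ge> 1" using c(1)[OF n1] C by (simp add: one_enat_def)
    define N where "N = n div D"
    have N1: "N \<ge> 1" using n(2) D by (simp add: N_def div_greater_zero_iff Suc_le_eq)
    have ND: "(CARD('d) + 2) * N * L \<le> n"
    proof -
      have "(CARD('d) + 2) * N * L = D * (n div D)" by (simp only: N_def D_def mult_ac)
      then show ?thesis by (simp only: times_div_less_eq_dividend)
    qed
    have "enat L \<le> \<l> n" using L(3) mono_onD[OF l(2), of n0 n] n(1) L(2) n1 by (auto intro: order_trans)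
    then have main: "real n powr (- \<alpha> * (1 - \<beta>)) * (real C ^ L * real N ^ k) powr \<omega> \<le> K powr (1 + \<delta>)"
      unfolding \<omega>_def \<delta>_def k_def
      by (intro embedding_slope_bound[OF p \<alpha> n1 l c(2) L(1) _ C C1 N1 ND \<beta>(1) K emb])
    \<comment> \<open>Rounding down costs at most a factor 2 since N \<ge> 1.\<close>
    have "real n < real (D * (N + 1))"
      using dividend_less_times_div[of D n] D unfolding N_def of_nat_less_iff by simp
    also have "\<dots> \<le> real D * (2 * real N)" 
      unfolding of_nat_mult of_nat_add using N1 by (intro mult_left_mono) auto
    finally have Nn: "1 / (2 * real D) * real n \<le> real N" using D by (simp add: field_simps)
    have Cn: "K1 * (real n powr \<theta> * ln (2 * real n) powr \<kappa>) \<le> real C" using K1(2)[OF n1] C by (simp add: mult_ac)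
    have "(K1 * (real n powr \<theta> * ln (2 * real n) powr \<kappa>)) ^ L * (1 / (2 * real D) * real n) ^ k
        \<le> real C ^ L * real N ^ k"
      using Cn Nn K1(1) D by (intro mult_mono power_mono) auto
    then have "((K1 * (real n powr \<theta> * ln (2 * real n) powr \<kappa>)) ^ L * (1 / (2 * real D) * real n) ^ k) powr \<omega>
        \<le> (real C ^ L * real N ^ k) powr \<omega>"
      using \<omega> K1(1) D by (intro powr_mono2) auto
    moreover have "((K1 * (real n powr \<theta> * ln (2 * real n) powr \<kappa>)) ^ L * (1 / (2 * real D) * real n) ^ k) powr \<omega>
      = A * (real n powr (\<omega> * (\<theta> * real L + real k)) * ln (2 * real n) powr \<kappa>')"
    proof -
      have ln: "ln (2 * real n) > 0" using n1 by simp
      have 1: "(real n powr \<theta>) ^ L = real n powr (\<theta> * real L)" "real n ^ k = real n powr real k"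
        "(ln (2 * real n) powr \<kappa>) ^ L = ln (2 * real n) powr (\<kappa> * real L)"
        using n1 ln by (simp_all add: powr_realpow[symmetric] powr_powr)
      have "(K1 * (real n powr \<theta> * ln (2 * real n) powr \<kappa>)) ^ L * (1 / (2 * real D) * real n) ^ k
        = (K1 ^ L * (1 / (2 * real D)) ^ k) * (real n powr (\<theta> * real L + real k) * ln (2 * real n) powr (\<kappa> * real L))"
        unfolding power_mult_distrib 1 powr_add by (simp only: mult_ac)
      then show ?thesis using K1(1) D unfolding A_def \<kappa>'_def
        by (simp only: powr_mult powr_powr) (simp add: mult_ac)
    qed
    ultimately have "A * (real n powr (\<omega> * (\<theta> * real L + real k)) * ln (2 * real n) powr \<kappa>') \<le> (real C ^ L * real N ^ k) powr \<omega>"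
      by simp
    then have "real n powr (- \<alpha> * (1 - \<beta>)) * (A * (real n powr (\<omega> * (\<theta> * real L + real k)) * ln (2 * real n) powr \<kappa>'))
       \<le> real n powr (- \<alpha> * (1 - \<beta>)) * (real C ^ L * real N ^ k) powr \<omega>"
      by (rule mult_left_mono) simp
    also note main
    also have "real n powr (- \<alpha> * (1 - \<beta>)) * (A * (real n powr (\<omega> * (\<theta> * real L + real k)) * ln (2 * real n) powr \<kappa>'))
      = A * ((real n powr (- \<alpha> * (1 - \<beta>)) * real n powr (\<omega> * (\<theta> * real L + real k))) * ln (2 * real n) powr \<kappa>')"
      by (simp only: mult_ac)
    also have "real n powr (- \<alpha> * (1 - \<beta>)) * real n powr (\<omega> * (\<theta> * real L + real k)) = real n powr e"
      unfolding powr_add[symmetric] e_def by simp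
    finally show ?thesis .
  qed
  have "filterlim (\<lambda>n::nat. real n powr e * ln (2 * real n) powr \<kappa>') at_top sequentially"
    using e by real_asymp
  then have "\<forall>\<^sub>F n in sequentially. K powr (1 + \<delta>) / A < real n powr e * ln (2 * real n) powr \<kappa>'"
    by (rule filterlim_at_top_dense[THEN iffD1, rule_format])
  then have "\<forall>\<^sub>F n in sequentially. K powr (1 + \<delta>) / A < real n powr e * ln (2 * real n) powr \<kappa>' \<and> n \<ge> n0 \<and> n \<ge> D"
    by (intro eventually_conj eventually_ge_at_top)
  then obtain n where n: "K powr (1 + \<delta>) / A < real n powr e * ln (2 * real n) powr \<kappa>'" "n \<ge> n0" "n \<ge> D"
    by (auto dest!: eventually_happens)
  from n(1) have "K powr (1 + \<delta>) < A * (real n powr e * ln (2 * real n) powr \<kappa>')"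
    using A by (simp add: field_simps)
  then show False using bound[OF n(2,3)] by simp
qed

section \<open>The exponent for finite and infinite depth\<close>

lemma sup_depth_attained:
  assumes "enat L \<le> sup_depth \<l>" "L \<ge> 1"
  obtains n where "n \<ge> 1" "enat L \<le> \<l> n"
proof -
  \<comment> \<open>An infinite supremum may not be attained, but a strict lower bound is exceeded
    by some \<l> n, and exceeding L - 1 means reaching L.\<close>
  have "enat (L - 1) < sup_depth \<l>"
    by (rule less_le_trans[OF _ assms(1)]) (use assms(2) in simp)
  then obtain n where n: "n \<ge> 1" "enat (L - 1) < \<l> n"
    unfolding sup_depth_def less_SUP_iff by auto
  then have "enat L \<le> \<l> n" using assms(2) by (cases "\<l> n") auto
  with n(1) show thesis by (rule that)
qed

text \<open>For \<theta> = 0 the first summand is 0 * \<infinity> = 0, and the half depth alone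
  makes the value infinite.\<close>

lemma gamma_star_infinite:
  assumes "sup_depth \<l> = \<infinity>" "\<theta> \<ge> 0"
  shows "gamma_star \<theta> \<l> = \<infinity>"
  using assms by (cases "\<theta> = 0") (auto simp: gamma_star_def enat_half_def)

lemma gamma_star_finite:
  assumes "sup_depth \<l> = enat L"
  shows "gamma_star \<theta> \<l> = ereal (\<theta> * real L + real (L div 2))"
  using assms by (simp add: gamma_star_def enat_half_def)

lemma ereal_mult_infinity: "0 < r \<Longrightarrow> ereal r * \<infinity> = \<infinity>"
  by simp

theorem theorem1p2:
  fixes \<l> c :: "nat \<Rightarrow> enat" and p :: ereal and \<alpha> \<beta> \<theta> \<kappa> :: real
  assumes "0 < p" and "0 < \<alpha>"
    and "\<And>n. n \<ge> 1 \<Longrightarrow> \<l> n \<ge> 2" and "mono_on {1..} \<l>"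
    and "\<And>n. n \<ge> 1 \<Longrightarrow> c n \<ge> 1" and "mono_on {1..} c"
    and "\<theta> \<ge> 0"
    and "\<exists>K1 K2 :: real. K1 > 0 \<and> K2 > 0 \<and> (\<forall>n\<ge>1.
           ereal (K1 * real n powr \<theta> * ln (2 * real n) powr \<kappa>) \<le> ereal_of_enat (c n) \<and>
           ereal_of_enat (c n) \<le> ereal (K2 * real n powr \<theta> * ln (2 * real n) powr \<kappa>))"
    and "0 < \<beta>" and "\<beta> < 1"
  shows
    "(ereal \<alpha> > (ereal \<beta> + ereal (real CARD('d)) / p) / ereal (1 - \<beta>) * gamma_star \<theta> \<l> \<longrightarrow>
        embeds (approx_space \<l> c \<alpha> p :: (real^'d::finite \<Rightarrow> real) set) (approx_norm \<l> c \<alpha> p)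
               (hoelder_space \<beta>) (hoelder_norm \<beta>)) \<and>
     (ereal \<alpha> < (ereal \<beta> + ereal (real CARD('d)) / p) / ereal (1 - \<beta>) * gamma_star \<theta> \<l> \<longrightarrow>
        \<not> embeds (approx_space \<l> c \<alpha> p :: (real^'d \<Rightarrow> real) set) (approx_norm \<l> c \<alpha> p)
                 (hoelder_space \<beta>) (hoelder_norm \<beta>))"
proof -
  define \<delta> where "\<delta> = real CARD('d) * real_of_ereal (1 / p)"
  have \<delta>: "0 \<le> \<delta>" using assms(1) by (cases p) (auto simp: \<delta>_def one_ereal_def)
  \<comment> \<open>The prefactor of the threshold is a positive real, also for p = \<infinity>,
    where \<delta> = 0. So only \<gamma>* can make the threshold infinite.\<close>
  have ratio: "(ereal \<beta> + ereal (real CARD('d)) / p) / ereal (1 - \<beta>) = ereal ((\<beta> + \<delta>) / (1 - \<beta>))"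
    using assms(1,10) by (cases p) (auto simp: \<delta>_def one_ereal_def)
  have ratio_pos: "(\<beta> + \<delta>) / (1 - \<beta>) > 0" using assms(9,10) \<delta> by simp
  obtain K1 K2 where K: "K1 > 0"
    "\<And>n. n \<ge> 1 \<Longrightarrow> ereal (K1 * real n powr \<theta> * ln (2 * real n) powr \<kappa>) \<le> ereal_of_enat (c n)"
    "\<And>n. n \<ge> 1 \<Longrightarrow> ereal_of_enat (c n) \<le> ereal (K2 * real n powr \<theta> * ln (2 * real n) powr \<kappa>)"
    using assms(8) by blast
  have c_fin: "c n \<noteq> \<infinity>" if "n \<ge> 1" for n using K(3)[OF that] by (cases "c n") auto
  have "embeds (approx_space \<l> c \<alpha> p :: (real^'d \<Rightarrow> real) set) (approx_norm \<l> c \<alpha> p)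
          (hoelder_space \<beta>) (hoelder_norm \<beta>)"
    if gt: "ereal \<alpha> > ereal ((\<beta> + \<delta>) / (1 - \<beta>)) * gamma_star \<theta> \<l>"
  proof -
    \<comment> \<open>Infinite depth would make the threshold infinite, and no real \<alpha> exceeds
      that.\<close>
    obtain L where L: "sup_depth \<l> = enat L"
    proof (cases "sup_depth \<l>")
      case infinity
      have "ereal ((\<beta> + \<delta>) / (1 - \<beta>)) * \<infinity> = \<infinity>" by (rule ereal_mult_infinity[OF ratio_pos])
      with gt show ?thesis by (simp only: gamma_star_infinite[OF infinity assms(7)]) simp
    qed (use that in blast)
    have l: "\<l> n \<le> enat L" if "n \<ge> 1" for n
      unfolding L[symmetric] sup_depth_def using that by (intro SUP_upper) simp
    have "(\<beta> + \<delta>) / (1 - \<beta>) * (\<theta> * real L + real (L div 2)) < \<alpha>"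
      using gt by (simp add: gamma_star_finite[OF L])
    then have "(\<beta> + \<delta>) * (\<theta> * real L + real (L div 2)) < \<alpha> * (1 - \<beta>)"
      using assms(10) by (simp add: field_simps)
    note gt' = this[unfolded \<delta>_def]
    show ?thesis
    proof (rule approx_unit_ball_hoelder[where ?'d = 'd, OF assms(1,2) l assms(5) K(3) assms(7,9,10) gt'])
      fix C :: real
      assume "C > 0" "\<And>f :: real^'d \<Rightarrow> real. f \<in> borel_measurable cube_measure \<Longrightarrow> approx_Gamma \<l> c \<alpha> p f \<le> 1 \<Longrightarrow>
        \<exists>g. hoelder_bounded \<beta> C g \<and> (AE x in cube_measure. f x = g x)"
      then show ?thesis by (rule embeds_if_unit_ball[OF assms(9)])
    qed
  qed
  moreover have "\<not> embeds (approx_space \<l> c \<alpha> p :: (real^'d \<Rightarrow> real) set) (approx_norm \<l> c \<alpha> p)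
          (hoelder_space \<beta>) (hoelder_norm \<beta>)"
    if less: "ereal \<alpha> < ereal ((\<beta> + \<delta>) / (1 - \<beta>)) * gamma_star \<theta> \<l>"
  proof -
    obtain L where L: "L \<ge> 2" "enat L \<le> sup_depth \<l>"
      and La: "\<alpha> * (1 - \<beta>) < (\<beta> + \<delta>) * (\<theta> * real L + real (L div 2))"
    proof (cases "sup_depth \<l>")
      case (enat L)
      have "2 \<le> \<l> 1" using assms(3) by simp
      also have "\<dots> \<le> sup_depth \<l>" unfolding sup_depth_def by (intro SUP_upper) simp
      finally have "L \<ge> 2" by (simp add: enat numeral_eq_enat)
      moreover have "\<alpha> < (\<beta> + \<delta>) / (1 - \<beta>) * (\<theta> * real L + real (L div 2))"
        using less by (simp add: gamma_star_finite[OF enat])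
      then have "\<alpha> * (1 - \<beta>) < (\<beta> + \<delta>) * (\<theta> * real L + real (L div 2))"
        using assms(10) by (simp add: field_simps)
      ultimately show ?thesis using enat by (intro that[of L]) simp_all
    next
      case infinity
      \<comment> \<open>The half depth of 2 (k + 1) is k + 1, so this summand suffices even for
        \<theta> = 0; k + 1 instead of k ensures depth at least 2.\<close>
      obtain k :: nat where k: "\<alpha> * (1 - \<beta>) / (\<beta> + \<delta>) < real k"
        using reals_Archimedean2 by blast
      have "\<alpha> * (1 - \<beta>) < (\<beta> + \<delta>) * real k"
        using k assms(9) \<delta> by (simp add: field_simps)
      also have "\<dots> \<le> (\<beta> + \<delta>) * (\<theta> * real (2 * (k + 1)) + real (2 * (k + 1) div 2))"
        using assms(7,9) \<delta> by (intro mult_left_mono) (auto intro: add_increasing)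
      finally show ?thesis using infinity by (intro that[of "2 * (k + 1)"]) simp_all
    qed
    obtain n where "n \<ge> 1" "enat L \<le> \<l> n"
      using sup_depth_attained[OF L(2)] L(1) by auto
    then show ?thesis
      using not_embeds_small_alpha[where ?'d = 'd, OF assms(1-6) c_fin K(1,2) L(1) _ _ assms(9,10)] La
      by (simp add: \<delta>_def)
  qed
  ultimately show ?thesis unfolding ratio by blast
qed

end
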